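(* (i) Let $\mu\in(-1,1)$, $\mu\neq0$, and let $c$ be a real constant with $c<\mu+\frac12$. Let $$s_{\mu-\frac12,\frac12}(z)=\frac{z^{\mu+\frac12}}{\mu(\mu+1)}\,{}_1F_2\!\left(1;\frac{\mu+2}{2},\frac{\mu+3}{2};-\frac{z^2}{4}\right).$$ Then $$\mu(\mu+1)\left(z\,s_{\mu-\frac12,\frac12}'(z)-c\,s_{\mu-\frac12,\frac12}(z)\right)=z^{\mu+\frac12}\psi_\mu(z),$$ where $\psi_\mu$ is an even entire function belonging to the Laguerre–Pólya class $\mathcal{LP}$. Moreover, the smallest positive zero of $\psi_\mu$ does not exceed the first positive zero of $s_{\mu-\frac12,\frac12}$. (ii) Let $|\nu|<\frac12$ and let $d$ be a real constant with $d<\nu+1$. Let $$\mathbf H_\nu(z)=\frac{(z/2)^{\nu+1}}{\frac{\sqrt\pi}{2}\,\Gamma(\nu+\frac32)}\,{}_1F_2\!\left(1;\frac32,\nu+\frac32;-\frac{z^2}{4}\right)$$ be the Struve function. Then $$\frac{\sqrt\pi}{2}\Gamma\!\left(\nu+\tfrac32\right)\left(z\mathbf H_\nu'(z)-d\,\mathbf H_\nu(z)\right)=\left(\frac z2\right)^{\nu+1}\phi_\nu(z),$$ where $\phi_\nu$ is an entire function in the Laguerre–Pólya class $\mathcal{LP}$, and the smallest positive zero of $\phi_\nu$ does not exceed the first positive zero of $\mathbf H_\nu$.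
   Context: ${}_1F_2(a;b_1,b_2;x)=\sum_{k\ge0}\frac{(a)_k}{(b_1)_k(b_2)_k}\frac{x^k}{k!}$ with $(a)_k$ the Pochhammer symbol; the power $z^{\mu+1/2}$ (resp. $(z/2)^{\nu+1}$) denotes a fixed branch used consistently on both sides. A real entire function $\psi$ belongs to the Laguerre–Pólya class $\mathcal{LP}$ if it can be written as $\psi(x)=c\,x^m e^{-ax^2+\beta x}\prod_{k\ge1}(1+x/x_k)e^{-x/x_k}$ with $c,\beta,x_k\in\mathbb R$, $a\ge0$, $m\in\{0,1,2,\dots\}$ and $\sum_k x_k^{-2}<\infty$; equivalently, it is a locally uniform limit of real polynomials with only real zeros. *)

theory Defs
  imports "HOL-Analysis.Analysis"
begin

definition hyp1F2 :: "real \<Rightarrow> real \<Rightarrow> real \<Rightarrow> complex \<Rightarrow> complex" where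
  "hyp1F2 a b1 b2 z =
     (\<Sum>k. of_real (pochhammer a k / (pochhammer b1 k * pochhammer b2 k * fact k)) * z ^ k)"

text \<open>Laguerre--Polya class: c x^m e^{-a x^2 + beta x} prod_k (1 + x/x_k) e^{-x/x_k},
  a >= 0, sum x_k^{-2} < infinity.  The zeros are encoded by their reciprocals r k = 1/x_k;
  r k = 0 gives the trivial factor 1 (this allows finitely many zeros).  The infinite
  product is the limit of its partial products.\<close>
definition laguerre_polya :: "(real \<Rightarrow> real) \<Rightarrow> bool" where
  "laguerre_polya \<psi> \<longleftrightarrow>
     (\<exists>c a \<beta> (m::nat) (r::nat \<Rightarrow> real). a \<ge> 0 \<and> summable (\<lambda>k. (r k)\<^sup>2) \<and>
        (\<forall>x. (\<lambda>n. c * x ^ m * exp (- a * x\<^sup>2 + \<beta> * x) *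
                  (\<Prod>k<n. (1 + x * r k) * exp (- x * r k))) \<longlonglongrightarrow> \<psi> x))"

definition entire_LP :: "(complex \<Rightarrow> complex) \<Rightarrow> bool" where
  "entire_LP f \<longleftrightarrow> f holomorphic_on UNIV \<and> (\<forall>x::real. f (of_real x) \<in> \<real>) \<and>
     laguerre_polya (\<lambda>x. Re (f (of_real x)))"

text \<open>Slit plane where the principal branch of powr is used.\<close>
definition slit :: "complex set" where
  "slit = - {w. Im w = 0 \<and> Re w \<le> 0}"

definition lommel_s :: "real \<Rightarrow> complex \<Rightarrow> complex" where
  "lommel_s \<mu> z = z powr (of_real (\<mu> + 1/2)) / of_real (\<mu> * (\<mu> + 1)) *
      hyp1F2 1 ((\<mu> + 2) / 2) ((\<mu> + 3) / 2) (- z\<^sup>2 / 4)"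

definition struve_H :: "real \<Rightarrow> complex \<Rightarrow> complex" where
  "struve_H \<nu> z = (z / 2) powr (of_real (\<nu> + 1)) / of_real (sqrt pi / 2 * Gamma (\<nu> + 3/2)) *
      hyp1F2 1 (3/2) (\<nu> + 3/2) (- z\<^sup>2 / 4)"

end

theory Submission
  imports Defs "HOL-Complex_Analysis.Great_Picard"
begin

text \<open>
  Put \<open>\<Phi> z = 1F2(1; b1, b2; -z\<^sup>2/4)\<close>. Both claims concern \<open>\<psi> = z \<Phi>' + \<alpha> \<Phi>\<close> with \<open>\<alpha> > 0\<close>, and
  \<open>\<Phi>\<close> is the limit of the polynomials \<open>p\<^sub>n (z\<^sup>2 / (4 n\<^sup>2))\<close> with
  \<open>p\<^sub>n y = 3F2(-n, n + l, 1; b1, b2; y)\<close>. For a suitable \<open>l\<close> the polynomial \<open>p\<^sub>n\<close> is, at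
  \<open>y = (sin \<tau>)\<^sup>2\<close>, a sine or cosine sum with positive increasing coefficients, so by a discrete form
  of Polya's argument it changes sign between \<open>n + 1\<close> explicit points and has \<open>n\<close> simple positive
  zeros. These weights are discrete analogues of the densities \<open>(1 - t) powr \<mu>\<close>,
  \<open>(1 - t) powr (\<mu> - 1)\<close> and \<open>(1 - t\<^sup>2) powr (\<nu> - 1/2)\<close> in the Poisson-type integrals of \<open>\<Phi>\<close>.
  By Rolle's theorem \<open>2 y p\<^sub>n' + \<alpha> p\<^sub>n\<close> again has \<open>n\<close> simple positive zeros, and a compactness
  argument turns the limit of the resulting finite products into the canonical product of \<open>\<psi>\<close>.
\<close>

section \<open>Trigonometric sums with increasing coefficients\<close>

text \<open>\<open>x\<close> lists \<open>n\<close> distinct zeros. A nonzero polynomial of degree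
  at most \<open>n\<close> has no others, so they are then simple. The increasing order is what the
  Rolle step and the monotone arrays of reciprocals rely on.\<close>

definition has_positive_simple_roots :: "real poly \<Rightarrow> nat \<Rightarrow> bool" where
  "has_positive_simple_roots p n \<longleftrightarrow>
     (\<exists>x. strict_mono_on {..<n} x \<and> (\<forall>i<n. 0 < x i \<and> poly p (x i) = 0))"

lemma strict_mono_on_lessThan_nat:
  fixes x :: "nat \<Rightarrow> real"
  assumes "\<And>i. Suc i < n \<Longrightarrow> x i < x (Suc i)"
  shows "strict_mono_on {..<n} x"
proof (rule strict_mono_onI)
  fix i j assume "i \<in> {..<n}" "j \<in> {..<n}" "i < j"
  have "x i < x j" if "i < j" "j < n" for i j
    using that
  proof (induction j)
    case (Suc j)
    then show ?case
      using assms[of j] by (cases "i = j") fastforce+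
  qed simp
  then show "x i < x j" using \<open>i < j\<close> \<open>j \<in> {..<n}\<close> by auto
qed

text \<open>The intermediate value theorem puts a zero into each gap between consecutive nodes; the
  gaps are disjoint, so the zeros come out already ordered.\<close>

lemma has_positive_simple_roots_alternating:
  fixes p :: "real poly"
  assumes pos: "0 < t 0" and mono: "\<And>m. m < n \<Longrightarrow> t m < t (Suc m)"
    and alt: "\<And>m. m \<le> n \<Longrightarrow> (-1) ^ m * poly p (t m) > 0"
  shows "has_positive_simple_roots p n"
proof -
  have tpos: "0 < t m" if "m \<le> n" for m
    using that
  proof (induction m)
    case (Suc m)
    then show ?case using mono[of m] by simp
  qed (use pos in simp)
  have "\<exists>x. t m < x \<and> x < t (Suc m) \<and> poly p x = 0" if "m < n" for m
  proof -
    have "0 < ((-1) ^ m * poly p (t m)) * ((-1) ^ Suc m * poly p (t (Suc m)))"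
      by (intro mult_pos_pos alt) (use that in auto)
    also have "\<dots> = - (((-1) ^ m * (-1) ^ m) * (poly p (t m) * poly p (t (Suc m))))"
      by (simp add: algebra_simps)
    also have "\<dots> = - (poly p (t m) * poly p (t (Suc m)))"
      by (simp flip: power_add)
    finally show ?thesis
      using poly_IVT[OF mono[OF that], of p] by auto
  qed
  then obtain x where x: "\<And>m. m < n \<Longrightarrow> t m < x m \<and> x m < t (Suc m) \<and> poly p (x m) = 0"
    by metis
  show ?thesis
    unfolding has_positive_simple_roots_def
  proof (intro exI[of _ x] conjI strict_mono_on_lessThan_nat allI impI)
    show "x i < x (Suc i)" if "Suc i < n" for i
      using x[of i] x[of "Suc i"] that by force
    show "0 < x i" "poly p (x i) = 0" if "i < n" for i
      using x[of i] tpos[of i] that by force+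
  qed
qed

text \<open>Chebyshev polynomials of the third and second kind in the variable \<open>t = -4 (sin \<tau>)\<^sup>2\<close>. The terms
  with \<open>j > k\<close> vanish; the common bound \<open>n\<close> allows sums over \<open>k \<le> n\<close> to be exchanged.\<close>

definition cheb_V :: "nat \<Rightarrow> nat \<Rightarrow> real \<Rightarrow> real" where
  "cheb_V n k t = (\<Sum>j\<le>n. real ((k + j) choose (2 * j)) * t ^ j)"

definition cheb_U :: "nat \<Rightarrow> nat \<Rightarrow> real \<Rightarrow> real" where
  "cheb_U n k t = (\<Sum>j\<le>n. real ((k + 1 + j) choose (2 * j + 1)) * t ^ j)"

lemma cheb_V_0: "cheb_V n 0 t = 1"
proof -
  have "cheb_V n 0 t = (\<Sum>j\<in>{0}. real ((0 + j) choose (2 * j)) * t ^ j)"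
    unfolding cheb_V_def by (rule sum.mono_neutral_right) (auto simp: binomial_eq_0)
  then show ?thesis by simp
qed

lemma cheb_U_0: "cheb_U n 0 t = 1"
proof -
  have "cheb_U n 0 t = (\<Sum>j\<in>{0}. real ((0 + 1 + j) choose (2 * j + 1)) * t ^ j)"
    unfolding cheb_U_def by (rule sum.mono_neutral_right) (auto simp: binomial_eq_0)
  then show ?thesis by simp
qed

lemma cheb_U_Suc: "cheb_U n (Suc k) t = cheb_U n k t + cheb_V n (Suc k) t"
  unfolding cheb_U_def cheb_V_def sum.distrib[symmetric]
  by (intro sum.cong) (auto simp: algebra_simps)

text \<open>Pascal's rule, after splitting off the term \<open>j = 0\<close>. The bound
  \<open>k < n\<close> makes the top coefficient of \<open>cheb_U n k\<close> vanish; times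
  \<open>t\<close> it would otherwise exceed the truncation degree \<open>n\<close>.\<close>

lemma cheb_V_Suc:
  assumes "k < n"
  shows "cheb_V n (Suc k) t = cheb_V n k t + t * cheb_U n k t"
proof -
  obtain m where n: "n = Suc m" using assms by (cases n) auto
  have "cheb_V n (Suc k) t =
      1 + (\<Sum>j\<le>m. real ((Suc k + Suc j) choose (2 * Suc j)) * t ^ Suc j)"
    unfolding cheb_V_def n by (subst sum.atMost_Suc_shift) simp
  also have "\<dots> = 1 + (\<Sum>j\<le>m. real ((k + Suc j) choose (2 * Suc j)) * t ^ Suc j)
      + (\<Sum>j\<le>m. real ((k + 1 + j) choose (2 * j + 1)) * t ^ Suc j)"
    by (simp add: algebra_simps flip: sum.distrib)
  also have "(\<Sum>j\<le>m. real ((k + 1 + j) choose (2 * j + 1)) * t ^ Suc j) = t * cheb_U n k t"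
    using assms unfolding cheb_U_def n
    by (simp add: sum_distrib_left algebra_simps binomial_eq_0)
  also have "1 + (\<Sum>j\<le>m. real ((k + Suc j) choose (2 * Suc j)) * t ^ Suc j) = cheb_V n k t"
    unfolding cheb_V_def n by (subst sum.atMost_Suc_shift) simp
  finally show ?thesis .
qed

text \<open>The Pascal recurrences of \<open>cheb_V\<close> and \<open>cheb_U\<close> feed each
  other, so both identities share one induction, in which they become addition formulas. The
  multiplied-out form avoids dividing by \<open>cos \<tau>\<close> or
  \<open>sin (2 * \<tau>)\<close>.\<close>

lemma cheb_trig:
  fixes \<tau> :: real
  assumes "k \<le> n"
  shows "cheb_V n k (-4 * (sin \<tau>)\<^sup>2) * cos \<tau> = cos ((2 * real k + 1) * \<tau>) \<and>
         cheb_U n k (-4 * (sin \<tau>)\<^sup>2) * sin (2 * \<tau>) = sin ((2 * real k + 2) * \<tau>)"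
  using assms
proof (induction k)
  case 0
  then show ?case by (simp add: cheb_V_0 cheb_U_0)
next
  case (Suc k)
  define y where "y = -4 * (sin \<tau>)\<^sup>2"
  define A where "A = (2 * real k + 2) * \<tau>"
  have IH: "cheb_V n k y * cos \<tau> = cos (A - \<tau>)" "cheb_U n k y * sin (2 * \<tau>) = sin A"
    using Suc by (auto simp: y_def A_def algebra_simps)
  have s2: "sin (2 * \<tau>) = 2 * sin \<tau> * cos \<tau>" by (rule sin_double)
  have V: "cheb_V n (Suc k) y * cos \<tau> = cos (A + \<tau>)"
  proof -
    have "cheb_V n (Suc k) y * cos \<tau> = cheb_V n k y * cos \<tau> - 2 * sin \<tau> * (cheb_U n k y * sin (2 * \<tau>))"
      using Suc.prems by (simp only: s2 cheb_V_Suc Suc_le_lessD) (simp add: y_def algebra_simps power2_eq_square)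
    also have "\<dots> = cos (A + \<tau>)"
      unfolding IH by (simp add: cos_diff cos_add)
    finally show ?thesis .
  qed
  have "cheb_U n (Suc k) y * sin (2 * \<tau>) =
      cheb_U n k y * sin (2 * \<tau>) + 2 * sin \<tau> * (cheb_V n (Suc k) y * cos \<tau>)"
    by (simp only: cheb_U_Suc s2) (simp add: algebra_simps)
  also have "\<dots> = sin A + 2 * sin \<tau> * cos (A + \<tau>)"
    unfolding IH V by simp
  \<comment> \<open>Writing 1 as a sum of squares turns the goal into a polynomial identity in sines
    and cosines.\<close>
  also have "\<dots> = sin A * ((sin \<tau>)\<^sup>2 + (cos \<tau>)\<^sup>2) + 2 * sin \<tau> * cos (A + \<tau>)"
    by simp
  also have "\<dots> = sin (A + \<tau> + \<tau>)"
    by (simp only: sin_add cos_add) algebra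
  finally show ?case
    using V by (simp add: A_def y_def algebra_simps)
qed

text \<open>Abel summation in disguise; it is what forces the sign pattern in Polya's theorem on
  trigonometric sums with increasing coefficients.\<close>

lemma increasing_weights_sum_less:
  fixes a c :: "nat \<Rightarrow> real"
  assumes "0 < a 0" "\<And>k. k < n \<Longrightarrow> a k \<le> a (Suc k)" "\<And>k. c k \<le> 1" "c 0 < 1"
  shows "(\<Sum>k\<le>n. a k * (c k - c (Suc k))) < a n * (1 - c (Suc n))"
  using assms(2)
proof (induction n)
  case 0
  then show ?case using assms by simp
next
  case (Suc n)
  have "(\<Sum>k\<le>Suc n. a k * (c k - c (Suc k))) <
      a n * (1 - c (Suc n)) + a (Suc n) * (c (Suc n) - c (Suc (Suc n)))"
    using Suc by simp
  also have "\<dots> \<le> a (Suc n) * (1 - c (Suc n)) + a (Suc n) * (c (Suc n) - c (Suc (Suc n)))"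
    using Suc.prems[of n] assms(3)[of "Suc n"] by (simp add: mult_right_mono)
  finally show ?case by (simp add: algebra_simps)
qed

lemma sin_squared_mono:
  assumes "0 < s" "s < t" "t < pi / 2"
  shows "(sin s)\<^sup>2 < (sin t)\<^sup>2"
proof -
  have "sin s < sin t" using assms by (intro sin_monotone_2pi) auto
  moreover have "0 \<le> sin s" using assms by (intro sin_ge_zero) auto
  ultimately show ?thesis by (intro power_strict_mono) auto
qed

text \<open>Multiplied by \<open>2 * sin t * sin (2 * t)\<close>, the polynomial becomes a weighted
  sum of differences of cosines at odd multiples of \<open>t\<close>. At the extrema of the last
  cosine, \<open>increasing_weights_sum_less\<close> bounds that sum strictly by zero and so fixes
  the sign of \<open>p\<close>.\<close>

lemma has_positive_simple_roots_cheb_U: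
  fixes a :: "nat \<Rightarrow> real"
  assumes a: "0 < a 0" "\<And>k. k < n \<Longrightarrow> a k \<le> a (Suc k)"
    and p: "\<And>y. poly p y = (\<Sum>k\<le>n. a k * cheb_U n k (-4 * y))"
  shows "has_positive_simple_roots p n"
proof -
  \<comment> \<open>These are the points in (0, pi/2) where cos((2n+3) \<tau>) attains an extreme
    value, namely (-1)^(m+1).\<close>
  define \<tau> where "\<tau> m = (real m + 1) / (2 * real n + 3) * pi" for m
  have \<tau>: "0 < \<tau> m" "\<tau> m < pi / 2" if "m \<le> n" for m
  proof -
    have "(real m + 1) / (2 * real n + 3) < 1 / 2" using that by (simp add: field_simps)
    from mult_strict_right_mono[OF this pi_gt_zero] show "\<tau> m < pi / 2" by (simp add: \<tau>_def)
    show "0 < \<tau> m" by (auto simp: \<tau>_def intro!: mult_pos_pos divide_pos_pos)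
  qed
  show ?thesis
  proof (rule has_positive_simple_roots_alternating[where t = "\<lambda>m. (sin (\<tau> m))\<^sup>2"])
    show "0 < (sin (\<tau> 0))\<^sup>2"
      using \<tau>[of 0] sin_gt_zero[of "\<tau> 0"] by simp
    show "(sin (\<tau> m))\<^sup>2 < (sin (\<tau> (Suc m)))\<^sup>2" if "m < n" for m
      using that by (intro sin_squared_mono \<tau>)
        (auto simp: \<tau>_def intro!: mult_strict_right_mono divide_strict_right_mono)
    show "(-1) ^ m * poly p ((sin (\<tau> m))\<^sup>2) > 0" if "m \<le> n" for m
    proof -
      define t where "t = \<tau> m"
      have t: "0 < t" "t < pi / 2" using \<tau>[OF that] by (auto simp: t_def)
      have s: "0 < sin t" "0 < sin (2 * t)" using t by (auto intro!: sin_gt_zero)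
      \<comment> \<open>The sign is chosen to give \<open>c (Suc n) = 1\<close>, so that the bound
        \<open>a n * (1 - c (Suc n))\<close> is zero.\<close>
      define c where "c k = (-1) ^ Suc m * cos ((2 * real k + 1) * t)" for k
      have "(2 * real n + 3) * t = real (Suc m) * pi" by (simp add: t_def \<tau>_def)
      then have "cos ((2 * real n + 3) * t) = (-1) ^ Suc m" by (metis cos_npi)
      then have cn: "c (Suc n) = 1"
        by (simp add: c_def algebra_simps flip: power_add)
      have cabs: "\<bar>c k\<bar> = \<bar>cos ((2 * real k + 1) * t)\<bar>" for k
        by (simp add: c_def abs_mult power_abs)
      have c1: "c k \<le> 1" for k
        using cabs[of k] abs_cos_le_one[of "(2 * real k + 1) * t"] by linarith
      have "cos t < cos 0" "cos t > 0" using t by (intro cos_monotone_0_pi cos_gt_zero; auto)+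
      then have c0: "c 0 < 1" using cabs[of 0] by simp
      have *: "a k * (c k - c (Suc k)) =
          - ((-1) ^ m * (2 * sin t * sin (2 * t)) * (a k * cheb_U n k (-4 * (sin t)\<^sup>2)))"
        if "k \<le> n" for k
      proof -
        define A where "A = (2 * real k + 2) * t"
        have "c k - c (Suc k) = - ((-1) ^ m * (cos (A - t) - cos (A + t)))"
          by (simp add: c_def A_def algebra_simps)
        also have "\<dots> = - ((-1) ^ m * (2 * sin t * sin A))"
          by (simp add: cos_add cos_diff)
        also have "sin A = cheb_U n k (-4 * (sin t)\<^sup>2) * sin (2 * t)"
          using cheb_trig[OF that, of t] by (simp add: A_def)
        finally show ?thesis by (simp only: mult_minus_right mult_ac)
      qed
      have "0 > (\<Sum>k\<le>n. a k * (c k - c (Suc k)))"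
        using increasing_weights_sum_less[of a n c] a c1 c0 cn by simp
      also have "(\<Sum>k\<le>n. a k * (c k - c (Suc k))) =
          - ((-1) ^ m * (2 * sin t * sin (2 * t)) * poly p ((sin t)\<^sup>2))"
        using * by (simp add: p sum_negf sum_distrib_left)
      finally have "(2 * sin t * sin (2 * t)) * ((-1) ^ m * poly p ((sin t)\<^sup>2)) > 0"
        by (simp add: algebra_simps)
      moreover have "2 * sin t * sin (2 * t) > 0" using s by simp
      ultimately show ?thesis
        unfolding t_def by (simp only: zero_less_mult_pos)
    qed
  qed
qed

text \<open>The same argument with differences of sines at even multiples of \<open>t\<close>. The
  nodes are now the points where sin((2n+2) \<tau>) equals (-1)^m, and \<open>c 0 = 0\<close>
  supplies the strict inequality.\<close>

lemma has_positive_simple_roots_cheb_V: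
  fixes a :: "nat \<Rightarrow> real"
  assumes a: "0 < a 0" "\<And>k. k < n \<Longrightarrow> a k \<le> a (Suc k)"
    and p: "\<And>y. poly p y = (\<Sum>k\<le>n. a k * cheb_V n k (-4 * y))"
  shows "has_positive_simple_roots p n"
proof -
  define \<tau> where "\<tau> m = (2 * real m + 1) / (4 * real n + 4) * pi" for m
  have \<tau>: "0 < \<tau> m" "\<tau> m < pi / 2" if "m \<le> n" for m
  proof -
    have "(2 * real m + 1) / (4 * real n + 4) < 1 / 2" using that by (simp add: field_simps)
    from mult_strict_right_mono[OF this pi_gt_zero] show "\<tau> m < pi / 2" by (simp add: \<tau>_def)
    show "0 < \<tau> m" by (auto simp: \<tau>_def intro!: mult_pos_pos divide_pos_pos)
  qed
  show ?thesis
  proof (rule has_positive_simple_roots_alternating[where t = "\<lambda>m. (sin (\<tau> m))\<^sup>2"])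
    show "0 < (sin (\<tau> 0))\<^sup>2"
      using \<tau>[of 0] sin_gt_zero[of "\<tau> 0"] by simp
    show "(sin (\<tau> m))\<^sup>2 < (sin (\<tau> (Suc m)))\<^sup>2" if "m < n" for m
      using that by (intro sin_squared_mono \<tau>)
        (auto simp: \<tau>_def intro!: mult_strict_right_mono divide_strict_right_mono)
    show "(-1) ^ m * poly p ((sin (\<tau> m))\<^sup>2) > 0" if "m \<le> n" for m
    proof -
      define t where "t = \<tau> m"
      have t: "0 < t" "t < pi / 2" using \<tau>[OF that] by (auto simp: t_def)
      have s: "0 < sin t" "0 < cos t" using t by (auto intro!: sin_gt_zero cos_gt_zero)
      define c where "c k = (-1) ^ m * sin (2 * real k * t)" for k
      have "(2 * real n + 2) * t = pi / 2 + real m * pi"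
        by (simp add: t_def \<tau>_def field_simps)
      then have "sin ((2 * real n + 2) * t) = (-1) ^ m"
        by (metis add.commute cos_npi sin_add cos_pi_half sin_pi_half mult_zero_right mult_1_right add_0)
      then have cn: "c (Suc n) = 1"
        by (simp add: c_def algebra_simps flip: power_add)
      have c1: "c k \<le> 1" for k
      proof -
        have "\<bar>c k\<bar> = \<bar>sin (2 * real k * t)\<bar>" by (simp add: c_def abs_mult power_abs)
        then show ?thesis using abs_sin_le_one[of "2 * real k * t"] by linarith
      qed
      have *: "a k * (c k - c (Suc k)) =
          - ((-1) ^ m * (2 * sin t * cos t) * (a k * cheb_V n k (-4 * (sin t)\<^sup>2)))"
        if "k \<le> n" for k
      proof -
        define A where "A = (2 * real k + 1) * t"
        have "c k - c (Suc k) = - ((-1) ^ m * (sin (A + t) - sin (A - t)))"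
          by (simp add: c_def A_def algebra_simps)
        also have "\<dots> = - ((-1) ^ m * (2 * sin t * cos A))"
          by (simp add: sin_add sin_diff)
        also have "cos A = cheb_V n k (-4 * (sin t)\<^sup>2) * cos t"
          using cheb_trig[OF that, of t] by (simp add: A_def)
        finally show ?thesis by (simp only: mult_minus_right mult_ac)
      qed
      have "0 > (\<Sum>k\<le>n. a k * (c k - c (Suc k)))"
        using increasing_weights_sum_less[of a n c] a c1 cn by (simp add: c_def)
      also have "(\<Sum>k\<le>n. a k * (c k - c (Suc k))) =
          - ((-1) ^ m * (2 * sin t * cos t) * poly p ((sin t)\<^sup>2))"
        using * by (simp add: p sum_negf sum_distrib_left)
      finally have "(2 * sin t * cos t) * ((-1) ^ m * poly p ((sin t)\<^sup>2)) > 0"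
        by (simp add: algebra_simps)
      moreover have "2 * sin t * cos t > 0" using s by simp
      ultimately show ?thesis
        unfolding t_def by (simp only: zero_less_mult_pos)
    qed
  qed
qed

section \<open>Zeros of the approximating polynomials\<close>

text \<open>The numerator parameter 1 of the 3F2 contributes \<open>fact j\<close>, which cancels
  the factorial of the series. The parameter \<open>l\<close> is tuned to make the coefficients
  binomial sums; every \<open>l \<ge> 0\<close> gives the same rescaled limit.\<close>

definition hyp_poly :: "real \<Rightarrow> real \<Rightarrow> real \<Rightarrow> nat \<Rightarrow> real poly" where
  "hyp_poly l b1 b2 n =
     (\<Sum>j\<le>n. monom (pochhammer (- real n) j * pochhammer (real n + l) j /
                     (pochhammer b1 j * pochhammer b2 j)) j)"

lemma poly_hyp_poly:
  "poly (hyp_poly l b1 b2 n) y =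
     (\<Sum>j\<le>n. pochhammer (- real n) j * pochhammer (real n + l) j /
              (pochhammer b1 j * pochhammer b2 j) * y ^ j)"
  by (simp add: hyp_poly_def poly_sum poly_monom)

lemma has_positive_simple_roots_smult:
  assumes "has_positive_simple_roots (smult C p) n" "C \<noteq> 0"
  shows "has_positive_simple_roots p n"
  using assms by (auto simp: has_positive_simple_roots_def)

lemma sum_cheb_U:
  "(\<Sum>k\<le>n. a k * cheb_U n k t) =
     (\<Sum>j\<le>n. (\<Sum>k\<le>n. a k * real ((k + 1 + j) choose (2 * j + 1))) * t ^ j)"
  unfolding cheb_U_def sum_distrib_left sum_distrib_right
  by (subst sum.swap) (simp add: mult.assoc)

lemma sum_cheb_V:
  "(\<Sum>k\<le>n. a k * cheb_V n k t) =
     (\<Sum>j\<le>n. (\<Sum>k\<le>n. a k * real ((k + j) choose (2 * j))) * t ^ j)"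
  unfolding cheb_V_def sum_distrib_left sum_distrib_right
  by (subst sum.swap) (simp add: mult.assoc)

section \<open>Binomial convolutions and the coefficients of the Lommel and Struve
  polynomials\<close>

lemma rising_binomial_pos: "0 < b \<Longrightarrow> 0 < pochhammer b i / fact i" for b :: real
  by (simp add: pochhammer_pos)

text \<open>Consecutive quotients are (b+i)/(i+1), which is at most 1 because b is. Read at the
  reversed index \<open>n - k\<close>, this yields increasing weights.\<close>

lemma rising_binomial_antimono:
  fixes b :: real
  assumes "0 < b" "b \<le> 1"
  shows "pochhammer b (Suc i) / fact (Suc i) \<le> pochhammer b i / fact i"
proof -
  have "pochhammer b (Suc i) / fact (Suc i) = (b + real i) / (real i + 1) * (pochhammer b i / fact i)"
    by (simp add: pochhammer_rec' field_simps)
  also have "\<dots> \<le> 1 * (pochhammer b i / fact i)"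
    using assms by (intro mult_right_mono) (auto simp: pochhammer_pos less_imp_le)
  finally show ?thesis by simp
qed

lemma real_binomial_pochhammer:
  "real ((m + i) choose m) = pochhammer (real m + 1) i / fact i"
proof -
  have "(m + i) choose m = (m + i) choose i" using binomial_symmetric[of m "m + i"] by simp
  then show ?thesis by (simp add: binomial_gbinomial gbinomial_pochhammer')
qed

text \<open>Chu-Vandermonde: \<open>pochhammer a i / fact i\<close> is the coefficient of x^i in
  (1-x)^(-a), and such powers multiply by adding exponents.\<close>

lemma sum_rising_binomials:
  fixes a b :: real
  shows "(\<Sum>i\<le>n. pochhammer a i / fact i * (pochhammer b (n - i) / fact (n - i)))
           = pochhammer (a + b) n / fact n"
proof -
  have "pochhammer (a + b) n / fact n =
      (\<Sum>i\<le>n. real (n choose i) * pochhammer a i * pochhammer b (n - i) / fact n)"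
    by (simp add: pochhammer_binomial_sum sum_divide_distrib)
  also have "\<dots> = (\<Sum>i\<le>n. pochhammer a i / fact i * (pochhammer b (n - i) / fact (n - i)))"
    by (intro sum.cong) (auto simp: binomial_fact field_simps)
  finally show ?thesis ..
qed

text \<open>Terms with \<open>k < j\<close> vanish, and the remaining binomials are rising
  factorials with parameter 2j+s+1, so Chu-Vandermonde applies. The case s = 0 serves
  \<open>cheb_V\<close>, s = 1 serves \<open>cheb_U\<close>.\<close>

lemma sum_rising_binomial_shift:
  fixes b :: real
  assumes "j \<le> n"
  shows "(\<Sum>k\<le>n. pochhammer b (n - k) / fact (n - k) * real ((k + s + j) choose (2 * j + s)))
           = pochhammer (b + real (2 * j + s) + 1) (n - j) / fact (n - j)"
proof -
  have "(\<Sum>k\<le>n. pochhammer b (n - k) / fact (n - k) * real ((k + s + j) choose (2 * j + s)))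
      = (\<Sum>k\<in>{j..n}. pochhammer b (n - k) / fact (n - k) * real ((k + s + j) choose (2 * j + s)))"
    by (rule sum.mono_neutral_right) (auto simp: binomial_eq_0)
  also have "\<dots> = (\<Sum>i\<le>n-j. pochhammer b (n - j - i) / fact (n - j - i)
                          * real ((2 * j + s + i) choose (2 * j + s)))"
    using assms
    by (intro sum.reindex_bij_witness[of _ "\<lambda>i. i + j" "\<lambda>k. k - j"]) (auto simp: algebra_simps)
  also have "\<dots> = (\<Sum>i\<le>n-j. pochhammer (real (2 * j + s) + 1) i / fact i
                     * (pochhammer b (n - j - i) / fact (n - j - i)))"
    by (subst real_binomial_pochhammer) (simp add: mult.commute)
  also have "\<dots> = pochhammer (b + real (2 * j + s) + 1) (n - j) / fact (n - j)"
    by (subst sum_rising_binomials) (simp add: algebra_simps)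
  finally show ?thesis .
qed

lemma pochhammer_minus_of_nat:
  assumes "j \<le> n"
  shows "pochhammer (- real n) j = (-1) ^ j * fact n / fact (n - j)"
proof -
  have "real (n choose j) = (-1) ^ j * pochhammer (- real n) j / fact j"
    by (simp add: binomial_gbinomial gbinomial_pochhammer)
  then have "fact n / (fact j * fact (n - j)) = (-1) ^ j * pochhammer (- real n) j / fact j"
    using assms by (simp add: binomial_fact)
  then have "fact n / fact (n - j) = (-1) ^ j * pochhammer (- real n) j"
    by (simp add: field_simps)
  then have "(-1) ^ j * fact n / fact (n - j) = ((-1) ^ j * (-1) ^ j) * pochhammer (- real n) j"
    by (metis mult.assoc times_divide_eq_right)
  then show ?thesis by (simp flip: power_add)
qed

text \<open>The choice l = \<mu>+2 pays off here: duplication turns the denominator into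
  (\<mu>+2)_{2j} / 4^j, and (\<mu>+2)_{n+j} can be split either after \<open>n\<close> or after
  \<open>2 * j\<close> factors.\<close>

lemma lommel_coefficient:
  fixes \<mu> :: real
  assumes "-1 < \<mu>" "j \<le> n"
  shows "pochhammer (\<mu> + 2) n / fact n *
           (pochhammer (- real n) j * pochhammer (real n + (\<mu> + 2)) j /
            (pochhammer ((\<mu> + 2) / 2) j * pochhammer ((\<mu> + 3) / 2) j))
         = pochhammer (\<mu> + 2 + real (2 * j)) (n - j) / fact (n - j) * (-4) ^ j"
proof -
  have "n + j = 2 * j + (n - j)" using assms by simp
  then have e: "pochhammer (\<mu> + 2) n * pochhammer (\<mu> + 2 + real n) j =
      pochhammer (\<mu> + 2) (2 * j) * pochhammer (\<mu> + 2 + real (2 * j)) (n - j)"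
    by (metis pochhammer_product')
  have d: "pochhammer (\<mu> + 2) (2 * j) = 4 ^ j * (pochhammer ((\<mu> + 2) / 2) j * pochhammer ((\<mu> + 3) / 2) j)"
  proof -
    have "(\<mu> + 2) / 2 + 1 / 2 = (\<mu> + 3) / 2" "2 * ((\<mu> + 2) / 2) = \<mu> + 2" by (auto simp: field_simps)
    with pochhammer_double[of "(\<mu> + 2) / 2" j] show ?thesis by (simp only:) (simp add: power_mult)
  qed
  have pos: "pochhammer ((\<mu> + 2) / 2) j > 0" "pochhammer ((\<mu> + 3) / 2) j > 0"
    using assms by (auto intro!: pochhammer_pos)
  define P where "P = pochhammer ((\<mu> + 2) / 2) j * pochhammer ((\<mu> + 3) / 2) j"
  have P: "P > 0" using pos by (simp add: P_def)
  define X where "X = pochhammer (\<mu> + 2 + real (2 * j)) (n - j)"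
  have e': "pochhammer (\<mu> + 2) n * pochhammer (real n + (\<mu> + 2)) j = 4 ^ j * P * X"
    using e d by (simp add: P_def X_def add.commute)
  have m: "(-4) ^ j = ((-1) ^ j * 4 ^ j :: real)" by (simp flip: power_mult_distrib)
  have "pochhammer (\<mu> + 2) n / fact n * (pochhammer (- real n) j * pochhammer (real n + (\<mu> + 2)) j / P)
     = (pochhammer (\<mu> + 2) n * pochhammer (real n + (\<mu> + 2)) j) * (pochhammer (- real n) j / (fact n * P))"
    by simp
  also have "\<dots> = 4 ^ j * P * X * ((-1) ^ j * fact n / fact (n - j) / (fact n * P))"
    by (simp only: e' pochhammer_minus_of_nat[OF assms(2)])
  also have "\<dots> = X / fact (n - j) * (-4) ^ j"
    using P by (simp add: m)
  finally show ?thesis unfolding P_def X_def .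
qed

text \<open>The weights decrease in \<open>n - k\<close> when their parameter lies in (0,1]. For
  \<mu> < 0 the \<open>cheb_V\<close> form has parameter \<mu>+1, for \<mu> > 0 the
  \<open>cheb_U\<close> form has parameter \<mu>; both convolve to the same coefficients.\<close>

lemma hyp_poly_roots_lommel:
  fixes \<mu> :: real
  assumes "-1 < \<mu>" "\<mu> < 1" "\<mu> \<noteq> 0"
  shows "has_positive_simple_roots (hyp_poly (\<mu> + 2) ((\<mu> + 2) / 2) ((\<mu> + 3) / 2) n) n"
    (is "has_positive_simple_roots ?p n")
proof -
  define C where "C = pochhammer (\<mu> + 2) n / fact n"
  have "C > 0" using assms by (auto simp: C_def intro!: pochhammer_pos divide_pos_pos)
  have p: "poly (smult C ?p) y =
      (\<Sum>j\<le>n. pochhammer (\<mu> + 2 + real (2 * j)) (n - j) / fact (n - j) * (-4 * y) ^ j)" for y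
  proof -
    have "poly (smult C ?p) y = (\<Sum>j\<le>n. C * (pochhammer (- real n) j * pochhammer (real n + (\<mu> + 2)) j /
            (pochhammer ((\<mu> + 2) / 2) j * pochhammer ((\<mu> + 3) / 2) j)) * y ^ j)"
      by (simp add: poly_hyp_poly sum_distrib_left mult.assoc)
    also have "\<dots> = (\<Sum>j\<le>n. pochhammer (\<mu> + 2 + real (2 * j)) (n - j) / fact (n - j) * (-4 * y) ^ j)"
      unfolding C_def
      by (intro sum.cong refl, subst lommel_coefficient)
         (use assms in \<open>simp_all only: power_mult_distrib mult.assoc atMost_iff\<close>)
    finally show ?thesis .
  qed
  have "has_positive_simple_roots (smult C ?p) n"
  proof (cases "\<mu> < 0")
    case True
    define a where "a k = pochhammer (\<mu> + 1) (n - k) / fact (n - k)" for k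
    show ?thesis
    proof (rule has_positive_simple_roots_cheb_V)
      show "0 < a 0" unfolding a_def using assms by (intro rising_binomial_pos) auto
      show "a k \<le> a (Suc k)" if "k < n" for k
        using rising_binomial_antimono[of "\<mu> + 1" "n - Suc k"] that True assms
        by (simp add: a_def Suc_diff_Suc)
      show "poly (smult C ?p) y = (\<Sum>k\<le>n. a k * cheb_V n k (- 4 * y))" for y
        unfolding p sum_cheb_V
      proof (intro sum.cong refl)
        fix j assume "j \<in> {..n}"
        then have "j \<le> n" by simp
        from sum_rising_binomial_shift[OF this, of "\<mu> + 1" 0]
        show "pochhammer (\<mu> + 2 + real (2 * j)) (n - j) / fact (n - j) * (- 4 * y) ^ j =
            (\<Sum>k\<le>n. a k * real (k + j choose (2 * j))) * (- 4 * y) ^ j"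
          by (simp add: a_def add_ac)
      qed
    qed
  next
    case False
    define a where "a k = pochhammer \<mu> (n - k) / fact (n - k)" for k
    show ?thesis
    proof (rule has_positive_simple_roots_cheb_U)
      show "0 < a 0" unfolding a_def using assms False by (intro rising_binomial_pos) auto
      show "a k \<le> a (Suc k)" if "k < n" for k
        using rising_binomial_antimono[of \<mu> "n - Suc k"] that False assms
        by (simp add: a_def Suc_diff_Suc)
      show "poly (smult C ?p) y = (\<Sum>k\<le>n. a k * cheb_U n k (- 4 * y))" for y
        unfolding p sum_cheb_U
      proof (intro sum.cong refl)
        fix j assume "j \<in> {..n}"
        then have "j \<le> n" by simp
        from sum_rising_binomial_shift[OF this, of \<mu> 1]
        show "pochhammer (\<mu> + 2 + real (2 * j)) (n - j) / fact (n - j) * (- 4 * y) ^ j =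
            (\<Sum>k\<le>n. a k * real (k + 1 + j choose (2 * j + 1))) * (- 4 * y) ^ j"
          by (simp add: a_def add_ac del: binomial_Suc_Suc)
      qed
    qed
  qed
  from has_positive_simple_roots_smult[OF this] show ?thesis
    using \<open>C > 0\<close> by simp
qed

text \<open>The product of two rising factorials is no plain convolution, so the sum is treated by
  creative telescoping. The resulting first-order recurrence in \<open>j\<close> is that of the
  hypergeometric coefficients.\<close>

lemma struve_binomial_sum_Suc:
  fixes b :: real and n :: nat
  assumes b: "0 < b"
  defines "A \<equiv> \<lambda>i. pochhammer b i / fact i"
  defines "S \<equiv> \<lambda>j. \<Sum>k\<le>n. A (n - k) * A (n + k + 2) * real ((k + 1 + j) choose (2 * j + 1))"
  shows "S (Suc j) * ((2 * real j + 3) * (real j + 1 + b) * 2)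
           = S j * ((real n - real j) * (real n + real j + 2 + b))"
proof -
  define N where "N = real n + 1"
  define c where "c j k = real ((k + 1 + j) choose (2 * j + 1))" for j k
  \<comment> \<open>The telescoping certificate. The factor \<open>N - real k\<close> kills it at
    \<open>k = n + 1\<close>, the binomial at \<open>k = 0\<close>. The factors
    \<open>N - real k\<close> and \<open>b + N + real k\<close> also let \<open>AS\<close> move both
    values of \<open>A\<close> to the arguments \<open>n - k\<close> and
    \<open>n + k + 2\<close>.\<close>
  define G where "G k = (A (n + 1 - k) * (N - real k)) * (A (n + k + 1) * (b + N + real k)) *
      ((real j + 1) * real ((k + 1 + j) choose (2 * j + 2)))" for k
  have AS: "A (Suc i) * (real i + 1) = A i * (b + real i)" for i
    by (simp add: A_def pochhammer_rec' divide_simps)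
  have r: "(2 * real j + 2) * real ((k + 1 + j) choose (2 * j + 2)) = c j k * (real k - real j)" for k
    using gbinomial_mult_1[of "real (k + 1 + j)" "2 * j + 1"]
    by (simp add: c_def binomial_gbinomial algebra_simps del: gbinomial_Suc_Suc binomial_Suc_Suc)
  have r': "(2 * real j + 2) * real ((k + 2 + j) choose (2 * j + 2)) = c j k * (real k + real j + 2)" for k
  proof -
    have "Suc (k + 1 + j) * ((k + 1 + j) choose (2 * j + 1)) = (Suc (k + 1 + j) choose Suc (2 * j + 1)) * Suc (2 * j + 1)"
      by (rule Suc_times_binomial_eq)
    from arg_cong[OF this, of real] show ?thesis
      by (simp add: c_def algebra_simps del: binomial_Suc_Suc)
  qed
  \<comment> \<open>With K = k+1, raising \<open>j\<close> multiplies the binomial by K^2 - (j+1)^2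
    up to a constant, so a factor K^2 can be traded for a shift in \<open>j\<close>.\<close>
  have cS: "c (Suc j) k * ((2 * real j + 2) * (2 * real j + 3)) =
      c j k * ((real k + 1)\<^sup>2 - (real j + 1)\<^sup>2)" for k
  proof -
    have "Suc (k + 1 + j) * ((k + 1 + j) choose (2 * j + 2)) = (Suc (k + 1 + j) choose Suc (2 * j + 2)) * Suc (2 * j + 2)"
      by (rule Suc_times_binomial_eq)
    from arg_cong[OF this, of real] have "c (Suc j) k * (2 * real j + 3) = (real k + real j + 2) * real ((k + 1 + j) choose (2 * j + 2))"
      by (simp add: c_def algebra_simps del: binomial_Suc_Suc)
    then have "c (Suc j) k * ((2 * real j + 2) * (2 * real j + 3)) =
        (real k + real j + 2) * ((2 * real j + 2) * real ((k + 1 + j) choose (2 * j + 2)))"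
      by algebra
    also have "\<dots> = c j k * ((real k + 1)\<^sup>2 - (real j + 1)\<^sup>2)"
      unfolding r by algebra
    finally show ?thesis .
  qed
  have tele: "G (Suc k) - G k = A (n - k) * A (n + k + 2) * c j k *
     ((real j + 1) * (N\<^sup>2 + b * N) - (real j + 1 + b) * (real k + 1)\<^sup>2)" if "k \<le> n" for k
  proof -
    define a where "a = A (n - k) * A (n + k + 2)"
    have d: "real (n - k) = N - 1 - real k" using that by (simp add: N_def)
    have g1: "2 * G (Suc k) = a * (N - 1 - real k) * (b + N + real k + 1) * (c j k * (real k + real j + 2))"
      unfolding r'[symmetric] by (simp add: G_def a_def algebra_simps)
    have "A (n + 1 - k) * (N - real k) = A (n - k) * (b + N - 1 - real k)"
      using AS[of "n - k"] that by (simp add: Suc_diff_le d algebra_simps)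
    moreover have "A (n + k + 1) * (b + N + real k) = A (n + k + 2) * (N + 1 + real k)"
      using AS[of "n + k + 1"] by (simp add: N_def algebra_simps)
    ultimately have g2: "2 * G k = a * (b + N - 1 - real k) * (N + 1 + real k) * (c j k * (real k - real j))"
      unfolding r[symmetric] by (simp add: G_def a_def)
    have "2 * (G (Suc k) - G k) = 2 * (a * c j k *
       ((real j + 1) * (N\<^sup>2 + b * N) - (real j + 1 + b) * (real k + 1)\<^sup>2))"
      using g1 g2 by algebra
    then show ?thesis by (simp add: a_def)
  qed
  have "(\<Sum>k\<le>n. G (Suc k) - G k) = G (Suc n) - G 0"
    using sum_lessThan_telescope[of G "Suc n"] by (simp add: lessThan_Suc_atMost)
  also have "\<dots> = 0" by (simp add: G_def N_def binomial_eq_0)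
  finally have "0 = (\<Sum>k\<le>n. A (n - k) * A (n + k + 2) * c j k *
     ((real j + 1) * (N\<^sup>2 + b * N) - (real j + 1 + b) * (real k + 1)\<^sup>2))"
    using tele by simp
  \<comment> \<open>K^2 is written as (K^2 - (j+1)^2) + (j+1)^2: the first part gives
    \<open>S (Suc j)\<close>, and what remains factors as (j+1)(N-j-1)(N+j+1+b).\<close>
  also have "\<dots> = (\<Sum>k\<le>n. A (n - k) * A (n + k + 2) * c j k *
       ((real j + 1) * (N - real j - 1) * (N + real j + 1 + b))
      - A (n - k) * A (n + k + 2) * c (Suc j) k *
       ((2 * real j + 2) * (2 * real j + 3) * (real j + 1 + b)))"
  proof (intro sum.cong refl)
    fix k
    show "A (n - k) * A (n + k + 2) * c j k *
        ((real j + 1) * (N\<^sup>2 + b * N) - (real j + 1 + b) * (real k + 1)\<^sup>2) =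
      A (n - k) * A (n + k + 2) * c j k *
       ((real j + 1) * (N - real j - 1) * (N + real j + 1 + b))
      - A (n - k) * A (n + k + 2) * c (Suc j) k *
       ((2 * real j + 2) * (2 * real j + 3) * (real j + 1 + b))"
      using cS[of k] by algebra
  qed
  also have "\<dots> = S j * ((real j + 1) * (N - real j - 1) * (N + real j + 1 + b))
      - S (Suc j) * ((2 * real j + 2) * (2 * real j + 3) * (real j + 1 + b))"
    by (simp add: sum_subtractf S_def c_def sum_distrib_right)
  finally have "(real j + 1) * (S (Suc j) * ((2 * real j + 3) * (real j + 1 + b) * 2)) =
      (real j + 1) * (S j * ((real n - real j) * (real n + real j + 2 + b)))"
    unfolding N_def by algebra
  then show ?thesis by simp
qed

text \<open>The binomial sums \<open>S j * (-4) ^ j\<close> and the coefficients of the polynomial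
  obey the same recurrence in \<open>j\<close>, so they agree up to the factor \<open>S 0\<close>.
  What is left is the monotonicity of the weights.\<close>

lemma hyp_poly_roots_struve:
  fixes \<nu> :: real
  assumes "\<bar>\<nu>\<bar> < 1 / 2"
  shows "has_positive_simple_roots (hyp_poly (\<nu> + 5 / 2) (3 / 2) (\<nu> + 3 / 2) n) n"
    (is "has_positive_simple_roots ?p n")
proof -
  define b where "b = \<nu> + 1 / 2"
  have b: "0 < b" "b \<le> 1" using assms by (auto simp: b_def)
  have bb: "\<nu> + 5 / 2 = b + 2" "\<nu> + 3 / 2 = b + 1" by (auto simp: b_def)
  define A where "A i = pochhammer b i / fact i" for i
  have Apos: "A i > 0" for i unfolding A_def by (rule rising_binomial_pos[OF b(1)])
  have AS: "A (Suc i) = A i * ((b + real i) / (real i + 1))" for i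
    by (simp add: A_def pochhammer_rec' field_simps)
  define a where "a k = A (n - k) * A (n + k + 2)" for k
  define S where "S j = (\<Sum>k\<le>n. a k * real ((k + 1 + j) choose (2 * j + 1)))" for j
  have S0: "S 0 > 0" unfolding S_def a_def
    by (intro sum_pos mult_pos_pos Apos) auto
  have SS: "S (Suc j) * ((2 * real j + 3) * (real j + 1 + b) * 2)
           = S j * ((real n - real j) * (real n + real j + 2 + b))" for j
    using struve_binomial_sum_Suc[OF b(1), of n j] by (simp add: S_def a_def A_def)
  have coeff: "S 0 * (pochhammer (- real n) j * pochhammer (real n + (b + 2)) j /
              (pochhammer (3 / 2) j * pochhammer (b + 1) j)) = S j * (-4) ^ j" for j
  proof (induction j)
    case (Suc j)
    define Q where "Q = pochhammer (3 / 2) j * pochhammer (b + 1) j"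
    define R where "R = pochhammer (- real n) j * pochhammer (real n + (b + 2)) j"
    have Q: "Q > 0" using b by (auto simp: Q_def intro!: mult_pos_pos pochhammer_pos)
    define u where "u = (3 / 2 + real j) * (b + 1 + real j)"
    have u: "u > 0" using b by (auto simp: u_def intro!: mult_pos_pos)
    define v where "v = (real n - real j) * (real n + real j + 2 + b)"
    have IH: "S 0 * (R / Q) = S j * (-4) ^ j" using Suc by (simp add: Q_def R_def)
    have "4 * u = (2 * real j + 3) * (real j + 1 + b) * 2" by (simp add: u_def field_simps)
    then have SS': "S (Suc j) * (4 * u) = S j * v"
      using SS[of j] by (simp only: v_def)
    have "S 0 * (pochhammer (- real n) (Suc j) * pochhammer (real n + (b + 2)) (Suc j) /
              (pochhammer (3 / 2) (Suc j) * pochhammer (b + 1) (Suc j))) = S 0 * ((R * - v) / (Q * u))"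
      unfolding R_def Q_def u_def v_def pochhammer_rec' by (simp add: algebra_simps)
    also have "\<dots> = S 0 * (R / Q) * (- v / u)" by simp
    also have "\<dots> = S j * v * (-4) ^ j * (- 1 / u)" unfolding IH by simp
    also have "\<dots> = S (Suc j) * (-4) ^ Suc j"
      unfolding SS'[symmetric] using u by simp
    finally show ?case .
  qed simp
  have "has_positive_simple_roots (smult (S 0) ?p) n"
  proof (rule has_positive_simple_roots_cheb_U)
    show "0 < a 0" by (simp add: a_def Apos)
    show "a k \<le> a (Suc k)" if "k < n" for k
    proof -
      define i where "i = n - Suc k"
      have i: "n - k = Suc i" "n - Suc k = i" using that by (auto simp: i_def)
      define s where "s = n + k + 2"
      have "i \<le> s" using i by (simp add: s_def)
      have pos: "0 < (b + real i) / (real i + 1)" using b by simp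
      \<comment> \<open>Passing from \<open>k\<close> to \<open>Suc k\<close> replaces
        \<open>A (Suc i) * A s\<close> by \<open>A i * A (Suc s)\<close>. The step quotient of
        \<open>A\<close> is nondecreasing in its index since b is at most 1, and
        \<open>i \<le> s\<close>.\<close>
      have "(b + real i) / (real i + 1) \<le> (b + real s) / (real s + 1)"
      proof -
        have "(1 - b) * real i \<le> (1 - b) * real s" using b \<open>i \<le> s\<close> by (intro mult_left_mono) auto
        then have "(b + real i) * (real s + 1) \<le> (b + real s) * (real i + 1)"
          by (simp add: algebra_simps)
        then show ?thesis
          by (simp add: pos_divide_le_eq pos_le_divide_eq)
      qed
      then have "A i * A s * ((b + real i) / (real i + 1)) \<le> A i * A s * ((b + real s) / (real s + 1))"
        using Apos by (intro mult_left_mono) (auto intro: less_imp_le)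
      then show ?thesis
        using AS[of i] AS[of s] i by (simp add: a_def s_def mult_ac)
    qed
    show "poly (smult (S 0) ?p) y = (\<Sum>k\<le>n. a k * cheb_U n k (- 4 * y))" for y
    proof -
      have "poly (smult (S 0) ?p) y = (\<Sum>j\<le>n. S 0 * (pochhammer (- real n) j * pochhammer (real n + (b + 2)) j /
              (pochhammer (3 / 2) j * pochhammer (b + 1) j)) * y ^ j)"
        by (simp add: poly_hyp_poly bb sum_distrib_left mult.assoc)
      also have "\<dots> = (\<Sum>j\<le>n. S j * (- 4 * y) ^ j)"
        unfolding coeff by (simp only: power_mult_distrib mult.assoc)
      finally show ?thesis unfolding sum_cheb_U S_def .
    qed
  qed
  from has_positive_simple_roots_smult[OF this] show ?thesis
    using S0 by simp
qed

section \<open>The Euler operator and convergence\<close>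

text \<open>Rolle's theorem for \<open>y powr \<beta> * f y\<close>.\<close>

lemma euler_operator_zero_between:
  fixes f f' :: "real \<Rightarrow> real"
  assumes "0 \<le> a" "a < b" "0 < \<beta>" and f: "\<And>y. (f has_real_derivative f' y) (at y)"
    and a: "a = 0 \<or> f a = 0" and b: "f b = 0"
  shows "\<exists>y. a < y \<and> y < b \<and> y * f' y + \<beta> * f y = 0"
proof -
  define h where "h y = y powr \<beta> * f y" for y
  define h' where "h' y = y powr \<beta> * f' y + \<beta> * y powr (\<beta> - 1) * f y" for y
  have h': "(h has_real_derivative h' y) (at y)" if "0 < y" for y
    unfolding h_def h'_def
    by (rule derivative_eq_intros f has_real_derivative_powr that refl)+ (simp add: algebra_simps)
  have "continuous_on {a..b} f"
    using has_field_derivative_at_within[OF f] by (rule DERIV_continuous_on)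
  then have cont: "continuous_on {a..b} h"
    unfolding h_def using assms(1,3) by (intro continuous_intros continuous_on_powr') auto
  \<comment> \<open>For \<open>a = 0\<close> the factor \<open>0 powr \<beta>\<close> is 0 whatever
    \<open>f 0\<close> is; this provides a zero to the left of the first zero of
    \<open>f\<close>.\<close>
  have "h a = h b" using a b by (auto simp: h_def)
  then have "\<exists>z. a < z \<and> z < b \<and> (*) (h' z) = (\<lambda>v. 0)"
    by (intro Rolle_deriv[of a b h "\<lambda>z. (*) (h' z)"] assms cont)
       (use h' assms(1) in \<open>auto simp: has_field_derivative_def\<close>)
  then obtain z where z: "a < z" "z < b" "(*) (h' z) = (\<lambda>v. 0)" by blast
  then have "h' z = 0" by (metis mult.right_neutral)
  have "0 < z" using z assms by simp
  have "z powr \<beta> = z powr (\<beta> - 1) * z"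
    using \<open>0 < z\<close> by (simp add: powr_diff)
  then have "h' z = z powr (\<beta> - 1) * (z * f' z + \<beta> * f z)"
    by (simp add: h'_def algebra_simps)
  then show ?thesis using z \<open>h' z = 0\<close> \<open>0 < z\<close> by auto
qed

text \<open>The operator is twice y d/dy + \<alpha>/2, so Rolle is used with exponent \<alpha>/2.
  Besides the gaps between zeros of \<open>p\<close> there is the gap from 0 to the first one, so
  the count stays \<open>n\<close>.\<close>

lemma has_positive_simple_roots_euler:
  assumes "has_positive_simple_roots p n" "0 < \<alpha>"
  shows "has_positive_simple_roots (smult 2 (pCons 0 (pderiv p)) + smult \<alpha> p) n"
    (is "has_positive_simple_roots ?q n")
proof -
  from assms obtain x where x: "strict_mono_on {..<n} x" "\<And>i. i < n \<Longrightarrow> 0 < x i \<and> poly p (x i) = 0"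
    by (auto simp: has_positive_simple_roots_def)
  define z where "z i = (if i = 0 then 0 else x (i - 1))" for i
  have "\<exists>y. z i < y \<and> y < x i \<and> poly ?q y = 0" if "i < n" for i
  proof -
    have "z i < x i"
      using that x(2)[of i] strict_mono_onD[OF x(1), of "i - 1" i] by (auto simp: z_def)
    moreover have "0 \<le> z i" "z i = 0 \<or> poly p (z i) = 0"
      using that x(2)[of "i - 1"] by (cases i; force simp: z_def)+
    ultimately obtain y where "z i < y" "y < x i" "y * poly (pderiv p) y + \<alpha> / 2 * poly p y = 0"
      using euler_operator_zero_between[of "z i" "x i" "\<alpha> / 2" "poly p" "poly (pderiv p)"]
        x(2)[OF \<open>i < n\<close>] assms(2) poly_DERIV by auto
    then show ?thesis by (intro exI[of _ y]) (auto simp: field_simps)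
  qed
  then obtain y where y: "\<And>i. i < n \<Longrightarrow> z i < y i \<and> y i < x i \<and> poly ?q (y i) = 0"
    by metis
  show ?thesis
    unfolding has_positive_simple_roots_def
  proof (intro exI[of _ y] conjI strict_mono_on_lessThan_nat allI impI)
    show "y i < y (Suc i)" if "Suc i < n" for i
      using y[of i] y[of "Suc i"] that by (auto simp: z_def)
    fix i assume i: "i < n"
    have "0 \<le> z i" using i x(2)[of "i - 1"] by (cases i) (force simp: z_def)+
    then show "0 < y i" "poly ?q (y i) = 0" using y[OF i] by auto
  qed
qed

text \<open>Both sides have degree at most \<open>n\<close> and agree at the \<open>n + 1\<close>
  points 0 and \<open>x i\<close>.\<close>

lemma poly_eq_prod_of_simple_roots:
  fixes q :: "real poly"
  assumes "degree q \<le> n" and x: "inj_on x {..<n}" "\<And>i. i < n \<Longrightarrow> 0 < x i \<and> poly q (x i) = 0"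
  shows "poly q y = poly q 0 * (\<Prod>i<n. 1 - y / x i)"
proof -
  define P where "P = smult (poly q 0) (\<Prod>i<n. [:1, - 1 / x i:])"
  have P: "poly P y = poly q 0 * (\<Prod>i<n. 1 - y / x i)" for y
    by (simp add: P_def poly_prod)
  have "degree (\<Prod>i<n. [:1, - 1 / x i:]) \<le> (\<Sum>i<n. degree [:1, - 1 / x i:])"
    by (rule order_trans[OF degree_prod_sum_le]) (auto simp: o_def)
  also have "\<dots> \<le> (\<Sum>i<n. 1)" by (intro sum_mono) simp
  finally have "degree (\<Prod>i<n. [:1, - 1 / x i:]) \<le> n" by simp
  then have "degree P \<le> n" unfolding P_def using degree_smult_le order_trans by blast
  have "q = P"
  proof (rule poly_eqI_degree[of "insert 0 (x ` {..<n})"])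
    have "0 \<notin> x ` {..<n}" using x(2) by force
    then have "card (insert 0 (x ` {..<n})) = Suc n"
      using x(1) by (simp add: card_image)
    then show "degree q < card (insert 0 (x ` {..<n}))" "degree P < card (insert 0 (x ` {..<n}))"
      using assms(1) \<open>degree P \<le> n\<close> by auto
    fix t assume "t \<in> insert 0 (x ` {..<n})"
    then consider "t = 0" | i where "i < n" "t = x i" by auto
    then show "poly q t = poly P t"
    proof cases
      case 2
      then have "(\<Prod>i<n. 1 - t / x i) = 0"
        using x(2)[of i] by (intro prod_zero bexI[of _ i]) auto
      then show ?thesis using 2 x(2)[of i] by (simp add: P)
    qed (simp add: P)
  qed
  then show ?thesis using P by metis
qed

lemma degree_hyp_poly: "degree (hyp_poly l b1 b2 n) \<le> n"
  unfolding hyp_poly_def by (intro degree_sum_le) (auto intro: order_trans[OF degree_monom_le])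

lemma poly_euler_hyp_poly:
  "poly (smult 2 (pCons 0 (pderiv (hyp_poly l b1 b2 n))) + smult \<alpha> (hyp_poly l b1 b2 n)) y =
     (\<Sum>j\<le>n. (2 * real j + \<alpha>) * (pochhammer (- real n) j * pochhammer (real n + l) j /
              (pochhammer b1 j * pochhammer b2 j) * y ^ j))"
proof -
  have *: "2 * (y * (real j * y ^ (j - 1))) = 2 * real j * y ^ j" for j
    by (cases j) auto
  have "poly (smult 2 (pCons 0 (pderiv (hyp_poly l b1 b2 n))) + smult \<alpha> (hyp_poly l b1 b2 n)) y =
     (\<Sum>j\<le>n. 2 * (y * poly (pderiv (monom (pochhammer (- real n) j * pochhammer (real n + l) j /
              (pochhammer b1 j * pochhammer b2 j)) j)) y)) + \<alpha> * poly (hyp_poly l b1 b2 n) y"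
    by (simp add: hyp_poly_def higher_pderiv_sum[of 1, simplified] poly_sum sum_distrib_left mult_ac)
  also have "\<dots> = (\<Sum>j\<le>n. (2 * real j + \<alpha>) * (pochhammer (- real n) j * pochhammer (real n + l) j /
              (pochhammer b1 j * pochhammer b2 j) * y ^ j))"
    unfolding poly_hyp_poly sum_distrib_left sum.distrib[symmetric]
  proof (intro sum.cong refl)
    fix j
    define C where "C = pochhammer (- real n) j * pochhammer (real n + l) j /
              (pochhammer b1 j * pochhammer b2 j)"
    have "2 * (y * poly (pderiv (monom C j)) y) = C * (2 * (y * (real j * y ^ (j - 1))))"
      by (simp add: pderiv_monom poly_monom)
    also have "\<dots> = C * (2 * real j * y ^ j)" unfolding * ..
    finally show "2 * (y * poly (pderiv (monom C j)) y) + \<alpha> * (C * y ^ j) = (2 * real j + \<alpha>) * (C * y ^ j)"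
      by (simp add: algebra_simps)
  qed
  finally show ?thesis .
qed

section \<open>Convergence of the rescaled polynomials\<close>

lemma summable_hyp_coeff:
  fixes b1 b2 R :: real
  assumes "0 < b1" "0 < b2"
  shows "summable (\<lambda>k. \<bar>R\<bar> ^ k / (pochhammer b1 k * pochhammer b2 k))"
proof -
  \<comment> \<open>From \<open>N\<close> on, \<open>real k * b2\<close> is at least
    \<open>2 * \<bar>R\<bar>\<close>, which pushes the quotient of consecutive terms down to
    1/2.\<close>
  obtain N :: nat where N: "2 * \<bar>R\<bar> / b2 < real N" using reals_Archimedean2 by blast
  show ?thesis
  proof (rule summable_ratio_test[of "1/2" N])
    fix k assume "N \<le> k"
    define P where "P = pochhammer b1 k * pochhammer b2 k"
    have P: "P > 0" using assms by (auto simp: P_def intro!: mult_pos_pos pochhammer_pos)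
    have "2 * \<bar>R\<bar> / b2 < real k" using N \<open>N \<le> k\<close> by linarith
    then have "2 * \<bar>R\<bar> \<le> real k * b2" using assms by (simp add: field_simps)
    also have "\<dots> \<le> (b1 + real k) * (b2 + real k)" using assms by (intro mult_mono) auto
    finally have le: "2 * \<bar>R\<bar> \<le> (b1 + real k) * (b2 + real k)" .
    have pos: "(b1 + real k) * (b2 + real k) > 0" using assms by (intro mult_pos_pos) auto
    have "\<bar>R\<bar> ^ Suc k / (pochhammer b1 (Suc k) * pochhammer b2 (Suc k)) =
        (\<bar>R\<bar> / ((b1 + real k) * (b2 + real k))) * (\<bar>R\<bar> ^ k / P)"
      by (simp add: P_def pochhammer_rec' mult_ac)
    also have "\<dots> \<le> 1 / 2 * (\<bar>R\<bar> ^ k / P)"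
      using le pos P by (intro mult_right_mono) (auto simp: field_simps)
    finally show "norm (\<bar>R\<bar> ^ Suc k / (pochhammer b1 (Suc k) * pochhammer b2 (Suc k))) \<le>
        1 / 2 * norm (\<bar>R\<bar> ^ k / (pochhammer b1 k * pochhammer b2 k))"
      using assms P by (simp add: P_def pochhammer_pos less_imp_le abs_mult)
  qed simp
qed

text \<open>There are \<open>k\<close> pairs of factors, and each pair divided by n^2 tends to
  -1.\<close>

lemma pochhammer_scaled_limit:
  "(\<lambda>n. pochhammer (- real n) k * pochhammer (real n + l) k / real n ^ (2 * k)) \<longlonglongrightarrow> (-1) ^ k"
proof (induction k)
  case (Suc k)
  have l: "(\<lambda>n. (- 1 + real k / real n) * (1 + (l + real k) / real n)) \<longlonglongrightarrow> (- 1 + 0) * (1 + 0)"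
    by (intro tendsto_intros lim_const_over_n)
  have "(\<lambda>n. (pochhammer (- real n) k * pochhammer (real n + l) k / real n ^ (2 * k)) *
        ((- 1 + real k / real n) * (1 + (l + real k) / real n))) \<longlonglongrightarrow> (-1) ^ k * ((- 1 + 0) * (1 + 0))"
    by (intro tendsto_mult Suc l)
  moreover have "\<forall>\<^sub>F n in sequentially. (pochhammer (- real n) k * pochhammer (real n + l) k / real n ^ (2 * k)) *
        ((- 1 + real k / real n) * (1 + (l + real k) / real n)) =
      pochhammer (- real n) (Suc k) * pochhammer (real n + l) (Suc k) / real n ^ (2 * Suc k)"
    using eventually_gt_at_top[of 0]
  proof eventually_elim
    case (elim n)
    have "(- 1 + real k / real n) = (- real n + real k) / real n"
      "(1 + (l + real k) / real n) = (real n + l + real k) / real n"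
      using elim by (auto simp: field_simps)
    then show ?case by (simp add: pochhammer_rec' mult_ac)
  qed
  ultimately show ?case by (simp add: filterlim_cong[OF refl refl])
qed simp

text \<open>The majorant, uniform in \<open>n\<close>, for exchanging limit and sum. For
  \<open>k \<le> n\<close> the factors of each pair, divided by n, are at most 1 and 2+l in absolute
  value; for larger \<open>k\<close> the first Pochhammer symbol vanishes.\<close>

lemma pochhammer_scaled_bound:
  assumes "0 \<le> l" "0 < n"
  shows "\<bar>pochhammer (- real n) k * pochhammer (real n + l) k / real n ^ (2 * k)\<bar> \<le> (2 + l) ^ k"
proof (cases "k \<le> n")
  case True
  then show ?thesis
  proof (induction k)
    case (Suc k)
    have "\<bar>pochhammer (- real n) (Suc k) * pochhammer (real n + l) (Suc k) / real n ^ (2 * Suc k)\<bar> =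
        \<bar>pochhammer (- real n) k * pochhammer (real n + l) k / real n ^ (2 * k)\<bar> *
        (\<bar>- real n + real k\<bar> / real n * (\<bar>real n + l + real k\<bar> / real n))"
      by (simp add: pochhammer_rec' abs_mult mult_ac)
    also have "\<dots> \<le> (2 + l) ^ k * (1 * (2 + l))"
    proof (intro mult_mono Suc)
      show "\<bar>- real n + real k\<bar> / real n \<le> 1" using Suc.prems assms by simp
      have "real n + l + real k \<le> real n + l * real n + real n"
        using Suc.prems assms mult_left_mono[of 1 "real n" l] by (intro add_mono) auto
      then show "\<bar>real n + l + real k\<bar> / real n \<le> 2 + l"
        using assms by (simp add: field_simps)
    qed (use Suc.prems assms in auto)
    finally show ?case by (simp add: mult_ac)
  qed simp
next
  case False
  then have "pochhammer (- real n) k = 0" by (simp add: pochhammer_of_nat_eq_0_lemma)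
  then show ?thesis using assms by simp
qed

text \<open>Tannery's theorem: the polynomial is an infinite series whose terms beyond
  \<open>n\<close> vanish, and it converges termwise under a summable majorant.\<close>

lemma euler_hyp_poly_limit:
  fixes b1 b2 l v :: real
  assumes "0 < b1" "0 < b2" "0 \<le> l" "0 < \<alpha>"
  shows "(\<lambda>n. poly (smult 2 (pCons 0 (pderiv (hyp_poly l b1 b2 n))) + smult \<alpha> (hyp_poly l b1 b2 n))
               (v / (real n)\<^sup>2))
     \<longlonglongrightarrow> (\<Sum>k. (2 * real k + \<alpha>) / (pochhammer b1 k * pochhammer b2 k) * (- v) ^ k)"
proof -
  define c where "c k = (2 * real k + \<alpha>) / (pochhammer b1 k * pochhammer b2 k)" for k
  define s where "s k n = pochhammer (- real n) k * pochhammer (real n + l) k / real n ^ (2 * k)" for k n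
  define a where "a k n = c k * v ^ k * s k n" for k n
  \<comment> \<open>The linear factor \<open>2 * real k + \<alpha>\<close> is absorbed into 2^k and
    the scaled Pochhammer symbols into (2+l)^k, which leaves a series covered by
    \<open>summable_hyp_coeff\<close>.\<close>
  define B where "B k = (2 + \<alpha>) * (\<bar>2 * ((2 + l) * \<bar>v\<bar>)\<bar> ^ k / (pochhammer b1 k * pochhammer b2 k))" for k
  have P: "pochhammer b1 k * pochhammer b2 k > 0" for k
    using assms by (auto intro!: mult_pos_pos pochhammer_pos)
  have cb: "\<bar>c k\<bar> \<le> (2 + \<alpha>) * 2 ^ k / (pochhammer b1 k * pochhammer b2 k)" for k
  proof -
    have "real k + 1 \<le> 2 ^ k" by (induction k) auto
    then have "(2 + \<alpha>) * (real k + 1) \<le> (2 + \<alpha>) * 2 ^ k" using assms by (intro mult_left_mono) auto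
    moreover have "2 * real k + \<alpha> \<le> (2 + \<alpha>) * (real k + 1)" using assms by (simp add: algebra_simps)
    ultimately have "2 * real k + \<alpha> \<le> (2 + \<alpha>) * 2 ^ k" by linarith
    then show ?thesis using P[of k] assms by (simp add: c_def divide_right_mono)
  qed
  have "((\<lambda>n. \<Sum>k. a k n) \<longlonglongrightarrow> (\<Sum>k. c k * (- v) ^ k))"
  proof (rule tannerys_theorem[where M = B, THEN conjunct2, THEN conjunct2])
    show "(\<lambda>n. a k n) \<longlonglongrightarrow> c k * (- v) ^ k" for k
    proof -
      have "(\<lambda>n. a k n) \<longlonglongrightarrow> c k * v ^ k * (-1) ^ k"
        unfolding a_def s_def by (intro tendsto_intros pochhammer_scaled_limit)
      then show ?thesis by (simp add: power_minus[of v] mult_ac)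
    qed
    have ab: "norm (a k n) \<le> B k" if "0 < n" for k n
    proof -
      have "norm (a k n) = \<bar>c k\<bar> * \<bar>v\<bar> ^ k * \<bar>s k n\<bar>" by (simp add: a_def abs_mult power_abs)
      also have "\<dots> \<le> (2 + \<alpha>) * 2 ^ k / (pochhammer b1 k * pochhammer b2 k) * \<bar>v\<bar> ^ k * (2 + l) ^ k"
        unfolding s_def using assms that P[of k]
        by (intro mult_mono cb pochhammer_scaled_bound order_refl) auto
      also have "\<dots> = B k"
      proof -
        have "\<bar>2 * ((2 + l) * \<bar>v\<bar>)\<bar> = 2 * ((2 + l) * \<bar>v\<bar>)" using assms by simp
        then show ?thesis by (simp only: B_def power_mult_distrib) simp
      qed
      finally show ?thesis .
    qed
    show "\<forall>\<^sub>F (k, n) in at_top \<times>\<^sub>F sequentially. norm (a k n) \<le> B k"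
      unfolding eventually_prod_filter
      by (intro exI[of _ "\<lambda>_. True"] exI[of _ "\<lambda>n. 0 < n"])
         (use ab eventually_gt_at_top[of 0] in auto)
    show "summable B" unfolding B_def
      by (intro summable_mult summable_hyp_coeff assms)
  qed simp
  also have "(\<lambda>n. \<Sum>k. a k n) = (\<lambda>n. poly (smult 2 (pCons 0 (pderiv (hyp_poly l b1 b2 n))) + smult \<alpha> (hyp_poly l b1 b2 n))
               (v / (real n)\<^sup>2))"
  proof
    fix n
    have "(\<Sum>k. a k n) = (\<Sum>k\<le>n. a k n)"
      by (rule suminf_finite) (auto simp: a_def s_def pochhammer_of_nat_eq_0_lemma)
    then show "(\<Sum>k. a k n) = poly (smult 2 (pCons 0 (pderiv (hyp_poly l b1 b2 n))) + smult \<alpha> (hyp_poly l b1 b2 n))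
               (v / (real n)\<^sup>2)"
      unfolding poly_euler_hyp_poly
      by (simp add: a_def c_def s_def power_divide power_mult[symmetric] mult_ac)
  qed
  finally show ?thesis unfolding c_def .
qed

section \<open>Limits of products with positive zeros\<close>

text \<open>Each factor 1 - (x^2/4) \<sigma>_k splits into (1 + x r)(1 - x r) with r =
  sqrt(\<sigma>_k)/2. Placing r and -r at adjacent indices makes the exponential factors of the
  canonical product cancel in pairs.\<close>

lemma even_LP_product:
  fixes \<sigma> :: "nat \<Rightarrow> real"
  assumes "0 \<le> a" "summable \<sigma>" "\<And>k. 0 \<le> \<sigma> k"
    and lim: "\<And>v. (\<lambda>n. exp (- a * v) * (\<Prod>k<n. 1 - v * \<sigma> k)) \<longlonglongrightarrow> g v"
  shows "laguerre_polya (\<lambda>x. C * g (x\<^sup>2 / 4))"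
proof -
  define r where "r k = (if even k then 1 else -1) * sqrt (\<sigma> (k div 2)) / 2" for k
  have r2: "(r k)\<^sup>2 = \<sigma> (k div 2) / 4" for k
    using assms(3) by (simp add: r_def power_divide power_mult_distrib)
  have "summable (\<lambda>k. (r k)\<^sup>2)"
  proof (rule bounded_imp_summable[where B = "suminf \<sigma>"])
    fix n
    have pairs: "(\<Sum>k<2 * m. \<sigma> (k div 2) / 4) = (\<Sum>k<m. \<sigma> k / 2)" for m
      by (induction m) auto
    have "(\<Sum>k\<le>n. (r k)\<^sup>2) \<le> (\<Sum>k<2 * Suc n. (r k)\<^sup>2)"
      by (intro sum_mono2) auto
    also have "\<dots> = (\<Sum>k<Suc n. \<sigma> k / 2)"
      unfolding r2 by (rule pairs)
    also have "\<dots> \<le> (\<Sum>k<Suc n. \<sigma> k)"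
      using assms(3) by (intro sum_mono) auto
    also have "\<dots> \<le> suminf \<sigma>" by (intro sum_le_suminf assms) auto
    finally show "(\<Sum>k\<le>n. (r k)\<^sup>2) \<le> suminf \<sigma>" .
  qed auto
  moreover have "(\<lambda>n. C * x ^ 0 * exp (- (a / 4) * x\<^sup>2 + 0 * x) *
      (\<Prod>k<n. (1 + x * r k) * exp (- x * r k))) \<longlonglongrightarrow> C * g (x\<^sup>2 / 4)" for x
  proof -
    define p where "p n = (\<Prod>k<n. (1 + x * r k) * exp (- x * r k))" for n
    define q where "q n = (\<Prod>k<n. 1 - x\<^sup>2 / 4 * \<sigma> k)" for n
    have even: "p (2 * n) = q n" for n
    proof (induction n)
      case (Suc n)
      have "p (2 * Suc n) = p (2 * n) * (((1 + x * r (2 * n)) * (1 - x * r (2 * n))) *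
          (exp (- x * r (2 * n)) * exp (x * r (2 * n))))"
        by (simp add: p_def r_def)
      also have "exp (- x * r (2 * n)) * exp (x * r (2 * n)) = 1"
        by (simp flip: exp_add)
      also have "(1 + x * r (2 * n)) * (1 - x * r (2 * n)) = 1 - x\<^sup>2 * (r (2 * n))\<^sup>2"
        by (simp add: algebra_simps power2_eq_square)
      finally show ?case by (simp add: Suc r2 q_def)
    qed (simp add: p_def q_def)
    \<comment> \<open>A partial product of odd length has one unpaired factor; it tends to 1 because
      \<open>r\<close> tends to 0.\<close>
    have p: "p n = q (n div 2) * (if even n then 1 else (1 + x * r (n - 1)) * exp (- x * r (n - 1)))" for n
    proof (cases "even n")
      case True
      then show ?thesis using even[of "n div 2"] by simp
    next
      case False
      then obtain m where m: "n = Suc (2 * m)" by (metis oddE Suc_eq_plus1)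
      have "p n = p (2 * m) * ((1 + x * r (2 * m)) * exp (- x * r (2 * m)))"
        by (simp add: p_def m)
      then show ?thesis by (simp add: m even)
    qed
    have "(\<lambda>k. sqrt ((r k)\<^sup>2)) \<longlonglongrightarrow> sqrt 0"
      by (intro tendsto_real_sqrt summable_LIMSEQ_zero) fact
    then have "r \<longlonglongrightarrow> 0" by (simp add: tendsto_rabs_zero_iff)
    then have r0: "(\<lambda>n. r (n - 1)) \<longlonglongrightarrow> 0"
      by (rule filterlim_compose) (rule filterlim_minus_const_nat_at_top)
    have "(\<lambda>n. (1 + x * r (n - 1)) * exp (- x * r (n - 1))) \<longlonglongrightarrow> (1 + x * 0) * exp (- x * 0)"
      by (intro tendsto_intros r0)
    then have "(\<lambda>n. (if even n then 1 else (1 + x * r (n - 1)) * exp (- x * r (n - 1)))) \<longlonglongrightarrow> 1"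
      by (intro filterlim_If) (auto intro: tendsto_mono[OF inf_le1])
    moreover have "filterlim (\<lambda>n::nat. n div 2) sequentially sequentially"
      unfolding filterlim_at_top
    proof
      show "\<forall>\<^sub>F n in sequentially. m \<le> n div 2" for m :: nat
        by (rule eventually_sequentiallyI[of "2 * m"]) auto
    qed
    then have "(\<lambda>n. exp (- a * (x\<^sup>2 / 4)) * q (n div 2)) \<longlonglongrightarrow> g (x\<^sup>2 / 4)"
      unfolding q_def by (rule filterlim_compose[OF lim])
    ultimately have "(\<lambda>n. C * ((exp (- a * (x\<^sup>2 / 4)) * q (n div 2)) *
         (if even n then 1 else (1 + x * r (n - 1)) * exp (- x * r (n - 1))))) \<longlonglongrightarrow> C * (g (x\<^sup>2 / 4) * 1)"
      by (intro tendsto_mult tendsto_const)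
    then show ?thesis
      unfolding p_def[symmetric] p by (simp add: mult.assoc)
  qed
  ultimately show ?thesis
    unfolding laguerre_polya_def using assms(1)
    by (intro exI[of _ C] exI[of _ "a / 4"] exI[of _ 0] exI[of _ r]) auto
qed

text \<open>The Gaussian factor \<open>exp (- a * v)\<close> absorbs the mass of the zeros that escape to infinity.\<close>

lemma limit_of_positive_root_products:
  fixes s :: "nat \<Rightarrow> nat \<Rightarrow> real"
  assumes nonneg: "\<And>n k. 0 \<le> s n k" and zero: "\<And>n k. n \<le> k \<Longrightarrow> s n k = 0"
    and anti: "\<And>n i k. i \<le> k \<Longrightarrow> s n k \<le> s n i"
    and lim: "\<And>v. (\<lambda>n. \<Prod>k<n. 1 - v * s n k) \<longlonglongrightarrow> g v"
  shows "\<exists>a \<sigma>. 0 \<le> a \<and> summable \<sigma> \<and> (\<forall>k. 0 \<le> \<sigma> k) \<and>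
    (\<forall>v. (\<lambda>n. exp (- a * v) * (\<Prod>k<n. 1 - v * \<sigma> k)) \<longlonglongrightarrow> g v)"
proof -
  \<comment> \<open>At v = -1 every factor is at least 1, so the bounded products bound the sums of
    the \<open>s n k\<close>.\<close>
  from lim[of "-1"] have "Bseq (\<lambda>n. \<Prod>k<n. 1 + s n k)"
    by (intro convergent_imp_Bseq convergentI) simp
  then obtain M where M: "\<And>n. \<bar>\<Prod>k<n. 1 + s n k\<bar> \<le> M" "0 < M"
    by (auto simp: Bseq_def)
  define T where "T n = (\<Sum>k<n. s n k)" for n
  have T: "0 \<le> T n" "T n \<le> M" for n
  proof -
    show "0 \<le> T n" unfolding T_def by (intro sum_nonneg nonneg)
    have "T n \<le> (\<Prod>k<n. 1 + s n k)" unfolding T_def by (intro sum_le_prod nonneg)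
    then show "T n \<le> M" using M(1)[of n] by linarith
  qed
  have psum: "(\<Sum>k<m. s n k) \<le> T n" for m n
  proof -
    have "(\<Sum>k<m. s n k) \<le> (\<Sum>k<max m n. s n k)"
      by (intro sum_mono2) (auto simp: nonneg)
    also have "\<dots> = T n"
      unfolding T_def by (intro sum.mono_neutral_right) (auto simp: zero)
    finally show ?thesis .
  qed
  \<comment> \<open>By monotonicity, \<open>s n k\<close> is at most the average of the first
    \<open>k + 1\<close> entries of its row.\<close>
  have sb: "s n k \<le> M / (real k + 1)" for n k
  proof -
    have "(real k + 1) * s n k = (\<Sum>i<Suc k. s n k)" by simp
    also have "\<dots> \<le> (\<Sum>i<Suc k. s n i)" by (intro sum_mono anti) simp
    also have "\<dots> \<le> M" using psum[of n "Suc k"] T(2)[of n] by linarith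
    finally show ?thesis by (simp add: field_simps)
  qed
  \<comment> \<open>Coordinate 0 holds the row sum and coordinate \<open>Suc i\<close> the entry
    \<open>s n i\<close>, so a single diagonal subsequence makes all of them converge.\<close>
  have "norm (case k of 0 \<Rightarrow> T n | Suc i \<Rightarrow> s n i) \<le> M" for n k
  proof (cases k)
    case 0
    then show ?thesis using T[of n] by simp
  next
    case (Suc i)
    have "s n i \<le> (\<Sum>k<Suc i. s n k)" by (simp add: sum_nonneg nonneg)
    then have "s n i \<le> M" using psum[of n "Suc i"] T(2)[of n] by linarith
    then show ?thesis using Suc nonneg[of n i] by simp
  qed
  then have "\<exists>r. strict_mono r \<and>
      (\<forall>k. \<exists>L. (\<lambda>n. case k of 0 \<Rightarrow> T (r n) | Suc i \<Rightarrow> s (r n) i) \<longlonglongrightarrow> L)"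
    by (rule function_convergent_subsequence[of "UNIV :: nat set"
          "\<lambda>n k. case k of 0 \<Rightarrow> T n | Suc i \<Rightarrow> s n i" M, OF countableI_type]) blast
  then obtain r where r: "strict_mono r"
      "\<And>k. \<exists>L. (\<lambda>n. case k of 0 \<Rightarrow> T (r n) | Suc i \<Rightarrow> s (r n) i) \<longlonglongrightarrow> L"
    by blast
  from r(2)[of 0] obtain \<tau> where \<tau>: "(\<lambda>n. T (r n)) \<longlonglongrightarrow> \<tau>" by auto
  have "\<exists>L. (\<lambda>n. s (r n) k) \<longlonglongrightarrow> L" for k using r(2)[of "Suc k"] by simp
  then obtain \<sigma> where \<sigma>: "\<And>k. (\<lambda>n. s (r n) k) \<longlonglongrightarrow> \<sigma> k" by metis
  have \<sigma>0: "0 \<le> \<sigma> k" for k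
    using nonneg by (intro tendsto_lowerbound[OF \<sigma>]) auto
  have \<sigma>b: "\<sigma> k \<le> M / (real k + 1)" for k
    using sb by (intro tendsto_upperbound[OF \<sigma>]) auto
  have \<sigma>\<tau>: "(\<Sum>k<m. \<sigma> k) \<le> \<tau>" for m
    using psum by (intro tendsto_le[OF _ \<tau> tendsto_sum[OF \<sigma>]]) auto
  have sum\<sigma>: "summable \<sigma>"
    using \<sigma>\<tau>[of "Suc _"] \<sigma>0 by (intro bounded_imp_summable[where B = \<tau>]) (auto simp: lessThan_Suc_atMost)
  \<comment> \<open>The mass lost in the limit: the row sums tend to \<tau>, while the limiting
    entries only sum to \<open>suminf \<sigma>\<close>.\<close>
  define a where "a = \<tau> - suminf \<sigma>"
  have "suminf \<sigma> \<le> \<tau>" using \<sigma>\<tau> by (intro suminf_le_const sum\<sigma>) auto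
  then have a0: "0 \<le> a" by (simp add: a_def)
  have "(\<lambda>n. exp (- a * v) * (\<Prod>k<n. 1 - v * \<sigma> k)) \<longlonglongrightarrow> g v" for v
  proof -
    \<comment> \<open>Beyond index \<open>K\<close> all factors are at least 1/2, so logarithms are
      safe; the first \<open>K\<close> factors may vanish or be negative and are kept as a finite
      product.\<close>
    obtain K :: nat where "2 * (\<bar>v\<bar> * M) < real K" using reals_Archimedean2 by blast
    then have K: "\<bar>v\<bar> * t \<le> 1 / 2" if "0 \<le> t" "t \<le> M / (real (k + K) + 1)" for t k
    proof -
      have "\<bar>v\<bar> * t \<le> \<bar>v\<bar> * (M / (real (k + K) + 1))" using that by (intro mult_left_mono) auto
      also have "\<dots> \<le> 1 / 2" using \<open>2 * (\<bar>v\<bar> * M) < real K\<close> by (simp add: field_simps)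
      finally show ?thesis .
    qed
    \<comment> \<open>Without its linear part the logarithm is O(t^2), hence dominated by a multiple
      of 1/(k+1)^2. The linear part has only the bound M/(k+1) and is carried by the row sums
      \<open>T\<close> instead.\<close>
    define L where "L t = ln (1 - v * t) + v * t" for t
    define B where "B k = 2 * (v\<^sup>2 * M\<^sup>2) * (1 / (real (Suc k))\<^sup>2)" for k
    have LB: "\<bar>L t\<bar> \<le> B k" and pos: "0 < 1 - v * t" if "0 \<le> t" "t \<le> M / (real (k + K) + 1)" for t k
    proof -
      have h: "\<bar>- (v * t)\<bar> \<le> 1 / 2" using K[OF that] that by (simp add: abs_mult)
      then show "0 < 1 - v * t" by linarith
      have "\<bar>L t\<bar> \<le> 2 * (- (v * t))\<^sup>2"
        using abs_ln_one_plus_x_minus_x_bound[OF h] by (simp add: L_def)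
      also have "\<dots> = 2 * v\<^sup>2 * t\<^sup>2" by (simp add: power_mult_distrib)
      also have "t \<le> M / real (Suc k)"
        using that M(2) by (intro order_trans[OF that(2)] divide_left_mono) auto
      then have "2 * v\<^sup>2 * t\<^sup>2 \<le> 2 * v\<^sup>2 * (M / real (Suc k))\<^sup>2"
        using that by (intro mult_left_mono power_mono) auto
      also have "\<dots> = B k" by (simp add: B_def power_divide)
      finally show "\<bar>L t\<bar> \<le> B k" .
    qed
    have sB: "summable B"
      unfolding B_def
      by (intro summable_mult summable_Suc_iff[THEN iffD2] inverse_power_summable[of 2, where 'a = real, unfolded inverse_eq_divide])
         simp
    have s': "s n (k + K) \<le> M / (real (k + K) + 1)" "\<sigma> (k + K) \<le> M / (real (k + K) + 1)" for n k
      by (rule sb \<sigma>b)+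
    have lim1: "(\<lambda>n. \<Sum>k. L (s (r n) (k + K))) \<longlonglongrightarrow> (\<Sum>k. L (\<sigma> (k + K)))"
    proof (rule tannerys_theorem[where M = B, THEN conjunct2, THEN conjunct2])
      show "(\<lambda>n. L (s (r n) (k + K))) \<longlonglongrightarrow> L (\<sigma> (k + K))" for k
        unfolding L_def using pos[OF \<sigma>0 s'(2)] by (intro tendsto_intros \<sigma>) (metis less_irrefl)
      show "\<forall>\<^sub>F (k, n) in at_top \<times>\<^sub>F sequentially. norm (L (s (r n) (k + K))) \<le> B k"
        using LB[OF nonneg s'(1)] by (intro always_eventually) auto
    qed (use sB in auto)
    have split: "(\<Prod>k<n. 1 - v * s n k) = (\<Prod>k<K. 1 - v * s n k) *
        exp ((\<Sum>k. L (s n (k + K))) - v * (T n - (\<Sum>k<K. s n k)))" if "K \<le> n" for n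
    proof -
      have "(\<Sum>k. L (s n (k + K))) = (\<Sum>k<n-K. L (s n (k + K)))"
        by (rule suminf_finite) (auto simp: zero L_def)
      also have "\<dots> = (\<Sum>k<n-K. ln (1 - v * s n (k + K))) + v * (\<Sum>k<n-K. s n (k + K))"
        by (simp add: L_def sum.distrib sum_distrib_left)
      also have "(\<Sum>k<n-K. s n (k + K)) = T n - (\<Sum>k<K. s n k)"
      proof -
        have "T n = (\<Sum>k<K. s n k) + (\<Sum>k\<in>{K..<n}. s n k)"
          unfolding T_def using that by (simp add: sum.atLeastLessThan_concat lessThan_atLeast0)
        also have "(\<Sum>k\<in>{K..<n}. s n k) = (\<Sum>k<n-K. s n (k + K))"
          using sum.shift_bounds_nat_ivl[of "s n" 0 K "n - K"] that by (simp add: lessThan_atLeast0)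
        finally show ?thesis by simp
      qed
      finally have "exp ((\<Sum>k. L (s n (k + K))) - v * (T n - (\<Sum>k<K. s n k))) =
          exp (\<Sum>k<n-K. ln (1 - v * s n (k + K)))"
        by simp
      also have "\<dots> = (\<Prod>k<n-K. 1 - v * s n (k + K))"
        using pos[OF nonneg s'(1)] by (simp add: exp_sum)
      also have "\<dots> = (\<Prod>k\<in>{K..<n}. 1 - v * s n k)"
        using prod.shift_bounds_nat_ivl[of "\<lambda>k. 1 - v * s n k" 0 K "n - K"] that
        by (simp add: lessThan_atLeast0)
      finally show ?thesis
        using that prod.atLeastLessThan_concat[of 0 K n "\<lambda>k. 1 - v * s n k"] by (simp add: lessThan_atLeast0)
    qed
    have lim2: "(\<lambda>n. (\<Prod>k<K. 1 - v * s (r n) k) *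
        exp ((\<Sum>k. L (s (r n) (k + K))) - v * (T (r n) - (\<Sum>k<K. s (r n) k)))) \<longlonglongrightarrow>
        (\<Prod>k<K. 1 - v * \<sigma> k) * exp ((\<Sum>k. L (\<sigma> (k + K))) - v * (\<tau> - (\<Sum>k<K. \<sigma> k)))"
      by (intro tendsto_intros lim1 \<sigma> \<tau>)
    have ev: "\<forall>\<^sub>F n in sequentially. (\<Prod>k<r n. 1 - v * s (r n) k) = (\<Prod>k<K. 1 - v * s (r n) k) *
        exp ((\<Sum>k. L (s (r n) (k + K))) - v * (T (r n) - (\<Sum>k<K. s (r n) k)))"
      using eventually_ge_at_top[of K]
    proof eventually_elim
      case (elim n)
      then have "K \<le> r n" using seq_suble[OF r(1), of n] by linarith
      then show ?case by (rule split)
    qed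
    \<comment> \<open>The whole sequence tends to \<open>g v\<close>, hence so does the subsequence,
      and comparing the two limits gives a formula for \<open>g v\<close>.\<close>
    have "(\<lambda>n. \<Prod>k<r n. 1 - v * s (r n) k) \<longlonglongrightarrow> g v"
      using LIMSEQ_subseq_LIMSEQ[OF lim r(1)] by (simp add: o_def)
    from LIMSEQ_unique[OF this tendsto_cong[OF ev, THEN iffD2, OF lim2]] have gv: "g v = (\<Prod>k<K. 1 - v * \<sigma> k) * exp ((\<Sum>k. L (\<sigma> (k + K))) - v * (\<tau> - (\<Sum>k<K. \<sigma> k)))"
      .
    have sumL: "summable (\<lambda>k. L (\<sigma> (k + K)))"
      using LB[OF \<sigma>0 s'(2)] by (intro summable_comparison_test[OF _ sB]) auto
    have sumK: "summable (\<lambda>k. \<sigma> (k + K))" using sum\<sigma> by (simp add: summable_iff_shift)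
    have "(\<lambda>m. exp (- a * v) * ((\<Prod>k<K. 1 - v * \<sigma> k) * exp ((\<Sum>k<m. L (\<sigma> (k + K))) - v * (\<Sum>k<m. \<sigma> (k + K)))))
      \<longlonglongrightarrow> exp (- a * v) * ((\<Prod>k<K. 1 - v * \<sigma> k) * exp ((\<Sum>k. L (\<sigma> (k + K))) - v * (\<Sum>k. \<sigma> (k + K))))"
      by (intro tendsto_intros summable_LIMSEQ sumL sumK)
    also have "(\<lambda>m. exp (- a * v) * ((\<Prod>k<K. 1 - v * \<sigma> k) * exp ((\<Sum>k<m. L (\<sigma> (k + K))) - v * (\<Sum>k<m. \<sigma> (k + K))))) =
      (\<lambda>m. exp (- a * v) * (\<Prod>k<m + K. 1 - v * \<sigma> k))"
    proof
      fix m
      have "exp ((\<Sum>k<m. L (\<sigma> (k + K))) - v * (\<Sum>k<m. \<sigma> (k + K))) = exp (\<Sum>k<m. ln (1 - v * \<sigma> (k + K)))"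
        by (simp add: L_def sum.distrib sum_distrib_left)
      also have "\<dots> = (\<Prod>k<m. 1 - v * \<sigma> (k + K))"
        using pos[OF \<sigma>0 s'(2)] by (simp add: exp_sum)
      also have "\<dots> = (\<Prod>k\<in>{K..<m + K}. 1 - v * \<sigma> k)"
        using prod.shift_bounds_nat_ivl[of "\<lambda>k. 1 - v * \<sigma> k" 0 K m] by (simp add: lessThan_atLeast0)
      finally show "exp (- a * v) * ((\<Prod>k<K. 1 - v * \<sigma> k) * exp ((\<Sum>k<m. L (\<sigma> (k + K))) - v * (\<Sum>k<m. \<sigma> (k + K)))) =
         exp (- a * v) * (\<Prod>k<m + K. 1 - v * \<sigma> k)"
        using prod.atLeastLessThan_concat[of 0 K "m + K" "\<lambda>k. 1 - v * \<sigma> k"] by (simp add: lessThan_atLeast0)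
    qed
    also have "exp (- a * v) * ((\<Prod>k<K. 1 - v * \<sigma> k) * exp ((\<Sum>k. L (\<sigma> (k + K))) - v * (\<Sum>k. \<sigma> (k + K)))) = g v"
    proof -
      have tail: "(\<Sum>k. \<sigma> (k + K)) = suminf \<sigma> - (\<Sum>k<K. \<sigma> k)"
        using suminf_minus_initial_segment[OF sum\<sigma>, of K] by simp
      have "exp (- a * v) * exp ((\<Sum>k. L (\<sigma> (k + K))) - v * (\<Sum>k. \<sigma> (k + K))) =
          exp ((\<Sum>k. L (\<sigma> (k + K))) - v * (\<tau> - (\<Sum>k<K. \<sigma> k)))"
        unfolding tail a_def by (simp add: algebra_simps flip: exp_add)
      then show ?thesis by (simp only: gv mult.left_commute[of "exp (- a * v)"])
    qed
    finally show ?thesis by (rule LIMSEQ_offset)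
  qed
  with a0 sum\<sigma> \<sigma>0 show ?thesis by blast
qed

section \<open>The hypergeometric function and the theorem\<close>

lemma hyp1F2_1: "hyp1F2 1 b1 b2 w = (\<Sum>k. of_real (1 / (pochhammer b1 k * pochhammer b2 k)) * w ^ k)"
  by (simp add: hyp1F2_def flip: pochhammer_fact)

lemma summable_hyp1F2_1:
  fixes w :: complex
  assumes "0 < b1" "0 < b2"
  shows "summable (\<lambda>k. of_real (1 / (pochhammer b1 k * pochhammer b2 k)) * w ^ k)"
proof (rule summable_norm_cancel)
  have "norm (of_real (1 / (pochhammer b1 k * pochhammer b2 k)) * w ^ k) =
      \<bar>cmod w\<bar> ^ k / (pochhammer b1 k * pochhammer b2 k)" for k
    using assms by (simp add: norm_mult norm_power norm_divide pochhammer_pos less_imp_le)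
  then show "summable (\<lambda>k. norm (of_real (1 / (pochhammer b1 k * pochhammer b2 k)) * w ^ k))"
    using summable_hyp_coeff[OF assms, of "cmod w"] by simp
qed

text \<open>With w = -z^2/4 one has z dw/dz = 2w, so z d/dz multiplies the coefficient of w^k by
  2k.\<close>

lemma euler_hyp1F2:
  fixes z :: complex and b1 b2 \<alpha> :: real
  assumes "0 < b1" "0 < b2"
  defines "\<Phi> \<equiv> \<lambda>z. hyp1F2 1 b1 b2 (- z\<^sup>2 / 4)"
  shows "\<Phi> field_differentiable (at z)"
    and "(\<lambda>k. of_real ((2 * real k + \<alpha>) / (pochhammer b1 k * pochhammer b2 k)) * (- z\<^sup>2 / 4) ^ k)
      sums (z * deriv \<Phi> z + of_real \<alpha> * \<Phi> z)"
proof -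
  define c :: "nat \<Rightarrow> complex" where "c k = of_real (1 / (pochhammer b1 k * pochhammer b2 k))" for k
  define w where "w = - z\<^sup>2 / 4"
  define D where "D = (\<Sum>k. diffs c k * w ^ k)"
  have sm: "summable (\<lambda>k. c k * w ^ k)" for w
    unfolding c_def by (rule summable_hyp1F2_1[OF assms(1,2)])
  have "((\<lambda>w. \<Sum>k. c k * w ^ k) has_field_derivative D) (at w)"
    unfolding D_def by (rule termdiffs_strong_converges_everywhere[OF sm])
  then have "((\<lambda>w. \<Sum>k. c k * w ^ k) \<circ> (\<lambda>z. - z\<^sup>2 / 4) has_field_derivative D * (- (2 * z) / 4)) (at z)"
    unfolding w_def by (intro DERIV_chain) (auto intro!: derivative_eq_intros)
  moreover have "(\<lambda>w. \<Sum>k. c k * w ^ k) \<circ> (\<lambda>z. - z\<^sup>2 / 4) = \<Phi>"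
    by (auto simp: \<Phi>_def hyp1F2_1 c_def o_def)
  ultimately have der: "(\<Phi> has_field_derivative D * (- (2 * z) / 4)) (at z)"
    by simp
  then show "\<Phi> field_differentiable (at z)" by (auto simp: field_differentiable_def)
  have "summable (\<lambda>k. diffs c k * w ^ k)"
    by (rule termdiff_converges_all) (rule sm)
  from sums_mult[OF diffs_equiv[OF this], of "2 * w"]
  have "(\<lambda>k. 2 * w * (of_nat k * c k * w ^ (k - Suc 0))) sums (2 * w * D)"
    by (simp add: D_def)
  \<comment> \<open>At \<open>k = 0\<close> the truncated exponent is harmless because of the factor
    \<open>of_nat k\<close>.\<close>
  moreover have "2 * w * (of_nat k * c k * w ^ (k - Suc 0)) = 2 * of_nat k * c k * w ^ k" for k
    by (cases k) auto
  ultimately have "(\<lambda>k. 2 * of_nat k * c k * w ^ k) sums (2 * w * D)" by simp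
  moreover have "(\<lambda>k. of_real \<alpha> * (c k * w ^ k)) sums (of_real \<alpha> * \<Phi> z)"
    using sums_mult[OF summable_sums[OF sm]] by (simp add: \<Phi>_def hyp1F2_1 c_def w_def)
  ultimately have "(\<lambda>k. 2 * of_nat k * c k * w ^ k + of_real \<alpha> * (c k * w ^ k)) sums
      (2 * w * D + of_real \<alpha> * \<Phi> z)"
    by (rule sums_add)
  moreover have "2 * of_nat k * c k * w ^ k + of_real \<alpha> * (c k * w ^ k) =
      of_real ((2 * real k + \<alpha>) / (pochhammer b1 k * pochhammer b2 k)) * w ^ k" for k
    by (simp add: c_def algebra_simps add_divide_distrib)
  moreover have "2 * w * D = z * deriv \<Phi> z"
    using DERIV_imp_deriv[OF der] by (simp add: w_def power2_eq_square)
  ultimately show "(\<lambda>k. of_real ((2 * real k + \<alpha>) / (pochhammer b1 k * pochhammer b2 k)) * (- z\<^sup>2 / 4) ^ k)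
      sums (z * deriv \<Phi> z + of_real \<alpha> * \<Phi> z)"
    unfolding w_def[symmetric] by (simp only:)
qed

text \<open>The rescaled Euler images of the polynomials factor over their positive zeros and
  converge to the series, so the limit theorem for products applies; \<open>\<alpha>\<close> is
  their common value at 0 and is divided out first.\<close>

lemma laguerre_polya_euler_series:
  fixes b1 b2 l \<alpha> :: real
  assumes "0 < b1" "0 < b2" "0 \<le> l" "0 < \<alpha>"
    and roots: "\<And>n. has_positive_simple_roots (hyp_poly l b1 b2 n) n"
  shows "laguerre_polya (\<lambda>x. \<Sum>k. (2 * real k + \<alpha>) / (pochhammer b1 k * pochhammer b2 k) * (- (x\<^sup>2 / 4)) ^ k)"
proof -
  define G where "G v = (\<Sum>k. (2 * real k + \<alpha>) / (pochhammer b1 k * pochhammer b2 k) * (- v) ^ k)" for v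
  define q where "q n = smult 2 (pCons 0 (pderiv (hyp_poly l b1 b2 n))) + smult \<alpha> (hyp_poly l b1 b2 n)" for n
  have "\<exists>x. strict_mono_on {..<n} x \<and> (\<forall>i<n. 0 < x i \<and> poly (q n) (x i) = 0)" for n
    using has_positive_simple_roots_euler[OF roots assms(4), of n]
    by (simp add: has_positive_simple_roots_def q_def)
  then obtain x where x: "\<And>n. strict_mono_on {..<n} (x n)"
      "\<And>n i. i < n \<Longrightarrow> 0 < x n i \<and> poly (q n) (x n i) = 0"
    by metis
  have q0: "poly (q n) 0 = \<alpha>" for n
  proof -
    have "poly (hyp_poly l b1 b2 n) 0 = 1"
      unfolding poly_hyp_poly by (subst sum.atMost_shift) simp
    then show ?thesis by (simp add: q_def)
  qed
  have "degree (q n) \<le> n" for n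
  proof -
    have "degree (pCons 0 (pderiv (hyp_poly l b1 b2 n))) \<le> n"
      using degree_hyp_poly[of l b1 b2 n] by (cases "degree (hyp_poly l b1 b2 n)")
        (auto simp: degree_pderiv degree_pCons_eq_if pderiv_eq_0_iff)
    then show ?thesis
      unfolding q_def using degree_hyp_poly[of l b1 b2 n]
      by (intro degree_add_le) (meson degree_smult_le order_trans)+
  qed
  then have q: "poly (q n) y = \<alpha> * (\<Prod>i<n. 1 - y / x n i)" for n y
    using poly_eq_prod_of_simple_roots[of "q n" n "x n" y] x strict_mono_on_imp_inj_on[OF x(1)] q0
    by auto
  \<comment> \<open>Reciprocals of the zeros in the variable v = n^2 y, padded by 0. They decrease
    in \<open>k\<close> because the zeros are listed in increasing order.\<close>
  define s where "s n k = (if k < n then 1 / ((real n)\<^sup>2 * x n k) else 0)" for n k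
  have prod: "(\<Prod>k<n. 1 - v * s n k) = poly (q n) (v / (real n)\<^sup>2) / \<alpha>" for n v
    using assms(4) by (simp add: q s_def)
  have "\<exists>a \<sigma>. 0 \<le> a \<and> summable \<sigma> \<and> (\<forall>k. 0 \<le> \<sigma> k) \<and>
    (\<forall>v. (\<lambda>n. exp (- a * v) * (\<Prod>k<n. 1 - v * \<sigma> k)) \<longlonglongrightarrow> G v / \<alpha>)"
  proof (rule limit_of_positive_root_products[of s "\<lambda>v. G v / \<alpha>"])
    show "0 \<le> s n k" for n k using x(2)[of k n] by (auto simp: s_def)
    show "s n k = 0" if "n \<le> k" for n k using that by (simp add: s_def)
    show "s n k \<le> s n i" if "i \<le> k" for n i k
    proof (cases "k < n")
      case True
      have "x n i \<le> x n k"
        using strict_mono_on_leD[OF x(1), of i n k] that True by simp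
      then show ?thesis
        using True that x(2)[of i n] x(2)[of k n]
        by (auto simp: s_def intro!: divide_left_mono mult_left_mono mult_pos_pos)
    next
      case False
      then show ?thesis using x(2)[of i n] by (auto simp: s_def)
    qed
    show "(\<lambda>n. \<Prod>k<n. 1 - v * s n k) \<longlonglongrightarrow> G v / \<alpha>" for v
      unfolding prod q_def G_def
      using assms by (intro tendsto_divide tendsto_const euler_hyp_poly_limit) auto
  qed
  then obtain a \<sigma> where "0 \<le> a" "summable \<sigma>" "\<And>k. 0 \<le> \<sigma> k"
    "\<And>v. (\<lambda>n. exp (- a * v) * (\<Prod>k<n. 1 - v * \<sigma> k)) \<longlonglongrightarrow> G v / \<alpha>"
    by blast
  from even_LP_product[OF this, of \<alpha>] show ?thesis
    using assms(4) by (simp add: G_def)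
qed

text \<open>The common core of both cases. The comparison of zeros applies the Rolle argument to
  \<Phi> itself on the interval from 0 to x.\<close>

theorem euler_hyp1F2_laguerre_polya:
  fixes b1 b2 l \<alpha> :: real
  assumes b: "0 < b1" "0 < b2" and "0 \<le> l" "0 < \<alpha>"
    and roots: "\<And>n. has_positive_simple_roots (hyp_poly l b1 b2 n) n"
    and \<Phi>_def: "\<Phi> = (\<lambda>z. hyp1F2 1 b1 b2 (- z\<^sup>2 / 4))"
    and \<psi>_def: "\<psi> = (\<lambda>z. z * deriv \<Phi> z + of_real \<alpha> * \<Phi> z)"
  shows "entire_LP \<psi>" and "\<psi> (- z) = \<psi> z"
    and "0 < x \<Longrightarrow> \<Phi> (of_real x) = 0 \<Longrightarrow> \<exists>y\<in>{0<..x}. \<psi> (of_real y) = 0"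
proof -
  have \<psi>: "(\<lambda>k. of_real ((2 * real k + \<alpha>) / (pochhammer b1 k * pochhammer b2 k)) * (- z\<^sup>2 / 4) ^ k) sums \<psi> z" for z
    unfolding \<psi>_def \<Phi>_def by (rule euler_hyp1F2(2)[OF b])
  show "\<psi> (- z) = \<psi> z" using sums_unique2[OF \<psi>[of "- z"]] \<psi>[of z] by simp
  have diff: "\<Phi> field_differentiable (at z)" for z
    unfolding \<Phi>_def by (rule euler_hyp1F2(1)[OF b])
  then have hol: "\<Phi> holomorphic_on UNIV" by (simp add: holomorphic_on_def)
  define g where "g x = (\<Sum>k. (2 * real k + \<alpha>) / (pochhammer b1 k * pochhammer b2 k) * (- (x\<^sup>2 / 4)) ^ k)" for x
  have \<psi>_real: "\<psi> (of_real x) = of_real (g x)" for x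
  proof -
    have "(\<lambda>k. of_real ((2 * real k + \<alpha>) / (pochhammer b1 k * pochhammer b2 k)) * (- (of_real x)\<^sup>2 / 4) ^ k :: complex)
      = (\<lambda>k. of_real ((2 * real k + \<alpha>) / (pochhammer b1 k * pochhammer b2 k) * (- (x\<^sup>2 / 4)) ^ k))"
      by (auto simp: fun_eq_iff)
    with \<psi>[of "of_real x"]
    have *: "(\<lambda>k. complex_of_real ((2 * real k + \<alpha>) / (pochhammer b1 k * pochhammer b2 k) * (- (x\<^sup>2 / 4)) ^ k)) sums \<psi> (of_real x)"
      by simp
    then have "summable (\<lambda>k. (2 * real k + \<alpha>) / (pochhammer b1 k * pochhammer b2 k) * (- (x\<^sup>2 / 4)) ^ k)"
      by (simp only: sums_iff summable_complex_of_real)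
    with * show ?thesis
      unfolding g_def by (simp only: sums_iff suminf_of_real)
  qed
  show "entire_LP \<psi>"
    unfolding entire_LP_def
  proof (intro conjI allI)
    show "\<psi> holomorphic_on UNIV"
      unfolding \<psi>_def by (intro holomorphic_intros hol holomorphic_deriv) auto
    show "\<psi> (of_real x) \<in> \<real>" for x by (simp add: \<psi>_real)
    show "laguerre_polya (\<lambda>x. Re (\<psi> (of_real x)))"
      unfolding \<psi>_real g_def using laguerre_polya_euler_series[OF assms(1-5)] by simp
  qed
  assume x: "0 < x" "\<Phi> (of_real x) = 0"
  \<comment> \<open>Rolle needs a real function; since \<psi> is real on the real axis, a zero of
    its real part there is a zero of \<psi>.\<close>
  have "((\<lambda>y. Re (\<Phi> (of_real y))) has_real_derivative Re (deriv \<Phi> (of_real y))) (at y)" for y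
  proof -
    have "(\<Phi> has_field_derivative deriv \<Phi> (of_real y)) (at (of_real y))"
      using diff by (simp add: DERIV_deriv_iff_field_differentiable)
    then have "((\<lambda>y. \<Phi> (of_real y)) has_vector_derivative deriv \<Phi> (of_real y)) (at y)"
      by (rule has_vector_derivative_real_field)
    then show ?thesis
      using bounded_linear.has_vector_derivative[OF bounded_linear_Re]
      by (auto simp: has_real_derivative_iff_has_vector_derivative)
  qed
  from euler_operator_zero_between[OF order_refl x(1) assms(4) this] x(2)
  obtain y where y: "0 < y" "y < x" "y * Re (deriv \<Phi> (of_real y)) + \<alpha> * Re (\<Phi> (of_real y)) = 0"
    by auto
  then have "Re (\<psi> (of_real y)) = 0" by (simp add: \<psi>_def)
  then have "\<psi> (of_real y) = 0" by (simp add: \<psi>_real)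
  then show "\<exists>y\<in>{0<..x}. \<psi> (of_real y) = 0" using y by force
qed

text \<open>On the slit plane, z d/dz multiplies the principal power (z/t)^s by s. Pulling the power
  out thus turns z d/dz - c into z d/dz + (s - c), so the bounds on c and d in the theorem say that
  the constant s - c is positive.\<close>

lemma euler_powr_mult:
  fixes \<Phi> :: "complex \<Rightarrow> complex" and t s c K :: real
  assumes z: "z \<in> slit" and "0 < t" "K \<noteq> 0" and diff: "\<Phi> field_differentiable (at z)"
    and F_def: "F = (\<lambda>z. (z / of_real t) powr of_real s / of_real K * \<Phi> z)"
  shows "of_real K * (z * deriv F z - of_real c * F z) =
    (z / of_real t) powr of_real s * (z * deriv \<Phi> z + of_real (s - c) * \<Phi> z)"
proof -
  have z': "z / of_real t \<notin> \<real>\<^sub>\<le>\<^sub>0" "z \<noteq> 0"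
    using z \<open>0 < t\<close> by (auto simp: slit_def complex_nonpos_Reals_iff divide_le_0_iff)
  define P where "P = (z / of_real t) powr of_real s"
  have P': "(z / of_real t) powr (of_real s - 1) = P * of_real t / z"
    using z' \<open>0 < t\<close> by (simp add: P_def powr_diff)
  have "((\<lambda>z. (z / of_real t) powr of_real s) has_field_derivative
      of_real s * (z / of_real t) powr (of_real s - 1) * (1 / of_real t)) (at z)"
    by (rule DERIV_chain2[where f = "\<lambda>z. z powr of_real s" and g = "\<lambda>z. z / of_real t"])
       (use z' in \<open>auto intro!: has_field_derivative_powr derivative_eq_intros\<close>)
  moreover have "of_real s * (z / of_real t) powr (of_real s - 1) * (1 / of_real t) = of_real s * P / z"
    using \<open>0 < t\<close> by (simp add: P')
  ultimately have "((\<lambda>z. (z / of_real t) powr of_real s) has_field_derivative of_real s * P / z) (at z)"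
    by simp
  moreover have "(\<Phi> has_field_derivative deriv \<Phi> z) (at z)"
    using diff by (simp add: DERIV_deriv_iff_field_differentiable)
  ultimately have "(F has_field_derivative
      (of_real s * P / z) / of_real K * \<Phi> z + deriv \<Phi> z * (P / of_real K)) (at z)"
    unfolding F_def P_def by (intro DERIV_mult DERIV_cdivide)
  then have "deriv F z = (of_real s * P / z) / of_real K * \<Phi> z + deriv \<Phi> z * (P / of_real K)"
    by (rule DERIV_imp_deriv)
  then show ?thesis
    using z'(2) assms(3) by (simp add: F_def flip: P_def) (simp add: field_simps)
qed

theorem theorem3:
  shows
  "(\<forall>(\<mu>::real) (c::real). -1 < \<mu> \<and> \<mu> < 1 \<and> \<mu> \<noteq> 0 \<and> c < \<mu> + 1/2 \<longrightarrow>
      (\<exists>\<psi> :: complex \<Rightarrow> complex.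
          entire_LP \<psi> \<and> (\<forall>z. \<psi> (- z) = \<psi> z) \<and>
          (\<forall>z\<in>slit. of_real (\<mu> * (\<mu> + 1)) *
               (z * deriv (lommel_s \<mu>) z - of_real c * lommel_s \<mu> z)
             = z powr (of_real (\<mu> + 1/2)) * \<psi> z) \<and>
          (\<forall>x>0. lommel_s \<mu> (of_real x) = 0 \<longrightarrow>
               (\<exists>y\<in>{0<..x}. \<psi> (of_real y) = 0))))
   \<and>
   (\<forall>(\<nu>::real) (d::real). \<bar>\<nu>\<bar> < 1/2 \<and> d < \<nu> + 1 \<longrightarrow>
      (\<exists>\<phi> :: complex \<Rightarrow> complex.
          entire_LP \<phi> \<and>
          (\<forall>z\<in>slit. of_real (sqrt pi / 2 * Gamma (\<nu> + 3/2)) *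
               (z * deriv (struve_H \<nu>) z - of_real d * struve_H \<nu> z)
             = (z / 2) powr (of_real (\<nu> + 1)) * \<phi> z) \<and>
          (\<forall>x>0. struve_H \<nu> (of_real x) = 0 \<longrightarrow>
               (\<exists>y\<in>{0<..x}. \<phi> (of_real y) = 0))))"
proof (intro conjI allI impI)
  fix \<mu> c :: real
  assume asm: "-1 < \<mu> \<and> \<mu> < 1 \<and> \<mu> \<noteq> 0 \<and> c < \<mu> + 1/2"
  define \<Phi> where "\<Phi> z = hyp1F2 1 ((\<mu> + 2) / 2) ((\<mu> + 3) / 2) (- z\<^sup>2 / 4)" for z
  define \<psi> where "\<psi> z = z * deriv \<Phi> z + of_real (\<mu> + 1/2 - c) * \<Phi> z" for z
  have pos: "0 < (\<mu> + 2) / 2" "0 < (\<mu> + 3) / 2" "0 \<le> \<mu> + 2" "0 < \<mu> + 1/2 - c" using asm by auto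
  have K: "\<mu> * (\<mu> + 1) \<noteq> 0" using asm by auto
  have roots: "has_positive_simple_roots (hyp_poly (\<mu> + 2) ((\<mu> + 2) / 2) ((\<mu> + 3) / 2) n) n" for n
    using asm by (intro hyp_poly_roots_lommel) auto
  have \<Phi>_eq: "\<Phi> = (\<lambda>z. hyp1F2 1 ((\<mu> + 2) / 2) ((\<mu> + 3) / 2) (- z\<^sup>2 / 4))"
    and \<psi>_eq: "\<psi> = (\<lambda>z. z * deriv \<Phi> z + of_real (\<mu> + 1/2 - c) * \<Phi> z)"
    by (simp_all add: \<Phi>_def \<psi>_def fun_eq_iff)
  have F: "lommel_s \<mu> = (\<lambda>z. (z / of_real 1) powr of_real (\<mu> + 1/2) / of_real (\<mu> * (\<mu> + 1)) * \<Phi> z)"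
    by (simp add: lommel_s_def \<Phi>_def fun_eq_iff)
  note main = euler_hyp1F2_laguerre_polya[OF pos roots \<Phi>_eq \<psi>_eq]
  show "\<exists>\<psi> :: complex \<Rightarrow> complex.
          entire_LP \<psi> \<and> (\<forall>z. \<psi> (- z) = \<psi> z) \<and>
          (\<forall>z\<in>slit. of_real (\<mu> * (\<mu> + 1)) *
               (z * deriv (lommel_s \<mu>) z - of_real c * lommel_s \<mu> z)
             = z powr (of_real (\<mu> + 1/2)) * \<psi> z) \<and>
          (\<forall>x>0. lommel_s \<mu> (of_real x) = 0 \<longrightarrow>
               (\<exists>y\<in>{0<..x}. \<psi> (of_real y) = 0))"
  proof (intro exI[of _ \<psi>] conjI allI ballI impI)
    show "entire_LP \<psi>" by (rule main(1))
    show "\<psi> (- z) = \<psi> z" for z by (rule main(2))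
    fix z assume "z \<in> slit"
    from euler_powr_mult[OF this zero_less_one K euler_hyp1F2(1)[OF pos(1,2), of z, folded \<Phi>_eq] F, of c]
    show "of_real (\<mu> * (\<mu> + 1)) * (z * deriv (lommel_s \<mu>) z - of_real c * lommel_s \<mu> z)
             = z powr (of_real (\<mu> + 1/2)) * \<psi> z"
      by (simp only: \<psi>_def of_real_1 div_by_1 of_real_numeral)
  next
    fix x :: real assume x: "0 < x" "lommel_s \<mu> (of_real x) = 0"
    \<comment> \<open>The power of a nonzero number is nonzero, so the zero must come from
      \<Phi>.\<close>
    then have "\<Phi> (of_real x) = 0" using K by (auto simp only: F mult_eq_0_iff divide_eq_0_iff powr_eq_0_iff of_real_eq_0_iff)
    with x(1) show "\<exists>y\<in>{0<..x}. \<psi> (of_real y) = 0" by (rule main(3))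
  qed
next
  fix \<nu> d :: real
  assume asm: "\<bar>\<nu>\<bar> < 1/2 \<and> d < \<nu> + 1"
  define \<Phi> where "\<Phi> z = hyp1F2 1 (3 / 2) (\<nu> + 3 / 2) (- z\<^sup>2 / 4)" for z
  define \<psi> where "\<psi> z = z * deriv \<Phi> z + of_real (\<nu> + 1 - d) * \<Phi> z" for z
  have pos: "0 < (3 / 2 :: real)" "0 < \<nu> + 3 / 2" "0 \<le> \<nu> + 5 / 2" "0 < \<nu> + 1 - d" using asm by auto
  have K: "sqrt pi / 2 * Gamma (\<nu> + 3/2) \<noteq> 0" using Gamma_real_pos[OF pos(2)] by simp
  have roots: "has_positive_simple_roots (hyp_poly (\<nu> + 5 / 2) (3 / 2) (\<nu> + 3 / 2) n) n" for n
    using asm by (intro hyp_poly_roots_struve) auto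
  have \<Phi>_eq: "\<Phi> = (\<lambda>z. hyp1F2 1 (3 / 2) (\<nu> + 3 / 2) (- z\<^sup>2 / 4))"
    and \<psi>_eq: "\<psi> = (\<lambda>z. z * deriv \<Phi> z + of_real (\<nu> + 1 - d) * \<Phi> z)"
    by (simp_all add: \<Phi>_def \<psi>_def fun_eq_iff)
  have F: "struve_H \<nu> = (\<lambda>z. (z / of_real 2) powr of_real (\<nu> + 1) / of_real (sqrt pi / 2 * Gamma (\<nu> + 3/2)) * \<Phi> z)"
    by (simp add: struve_H_def \<Phi>_def fun_eq_iff)
  note main = euler_hyp1F2_laguerre_polya[OF pos roots \<Phi>_eq \<psi>_eq]
  show "\<exists>\<phi> :: complex \<Rightarrow> complex.
          entire_LP \<phi> \<and>
          (\<forall>z\<in>slit. of_real (sqrt pi / 2 * Gamma (\<nu> + 3/2)) *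
               (z * deriv (struve_H \<nu>) z - of_real d * struve_H \<nu> z)
             = (z / 2) powr (of_real (\<nu> + 1)) * \<phi> z) \<and>
          (\<forall>x>0. struve_H \<nu> (of_real x) = 0 \<longrightarrow>
               (\<exists>y\<in>{0<..x}. \<phi> (of_real y) = 0))"
  proof (intro exI[of _ \<psi>] conjI allI ballI impI)
    show "entire_LP \<psi>" by (rule main(1))
    fix z assume "z \<in> slit"
    from euler_powr_mult[OF this zero_less_numeral K euler_hyp1F2(1)[OF pos(1,2), of z, folded \<Phi>_eq] F, of d]
    show "of_real (sqrt pi / 2 * Gamma (\<nu> + 3/2)) * (z * deriv (struve_H \<nu>) z - of_real d * struve_H \<nu> z)
             = (z / 2) powr (of_real (\<nu> + 1)) * \<psi> z"
      by (simp only: \<psi>_def of_real_1 div_by_1 of_real_numeral)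
  next
    fix x :: real assume x: "0 < x" "struve_H \<nu> (of_real x) = 0"
    then have "\<Phi> (of_real x) = 0" using K by (auto simp only: F mult_eq_0_iff divide_eq_0_iff powr_eq_0_iff of_real_eq_0_iff)
    with x(1) show "\<exists>y\<in>{0<..x}. \<psi> (of_real y) = 0" by (rule main(3))
  qed
qed

end
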